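(* Let $T$ be a contraction acting on a Hilbert space $\mathcal{H}$ and let $S$ be a unitary on $\mathcal{H}$. Then the following hold. (i) If there exists a sequence of unit vectors $(y_n)_{n\in \mathbb{N}}$ in $\mathcal{H}$ such that $$\lim_{n\to \infty} \left(1-\|Ty_n\|^2+\langle Ty_n,STy_n\rangle\right) \leq 0$$ (i.e. the limit exists and is a non-positive real number), then $\widetilde{U_T}\perp_B \widetilde{U_{ST}}$, where $\widetilde{U_T}$ and $\widetilde{U_{ST}}$ on $\mathcal{K}=\bigoplus_{-\infty}^\infty \mathcal{H}$ are the Schäffer unitary dilations of $T$ and $ST$ respectively. (ii) If $S$ commutes with $T$ and the maximal numerical range $\mathcal{W}(S)$ contains a non-positive real number, then there exists a pair of unitary operators $(U_T, U_{ST})$ that dilates the pair $(T,ST)$ on some Hilbert space $\mathcal{K}\supseteq \mathcal{H}$ such that $U_T\perp_B U_{ST}$.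
   Context: All Hilbert spaces are complex and separable, and all operators are bounded and linear; a contraction is an operator of norm at most $1$. For operators $X,Y$ on the same Hilbert space, $X\perp_B Y$ (Birkhoff-James orthogonality) means $\|X+\lambda Y\|\ge\|X\|$ for every $\lambda\in\mathbb{C}$ (operator norm). For a contraction $R$ on $\mathcal{H}$, $D_R=(I-R^*R)^{1/2}$ and $D_{R^*}=(I-RR^* )^{1/2}$. The Schäffer unitary dilation $\widetilde{U_R}$ of $R$ is the unitary operator on $\bigoplus_{n\in\mathbb{Z}}\mathcal{H}$ ($\ell^2$-direct sum) given by $\widetilde{U_R}(h_n)_{n\in\mathbb{Z}}=(h'_n)_{n\in\mathbb{Z}}$ with $h'_n=h_{n+1}$ for $n\le -2$ and for $n\ge 1$, $h'_{-1}=D_Rh_0-R^*h_1$, and $h'_0=Rh_0+D_{R^*}h_1$. The maximal numerical range of an operator $X$ is $\mathcal{W}(X)=\{\lambda\in\mathbb{C}:\ \text{there are unit vectors } x_n \text{ with } \lim_{n\to\infty}\|Xx_n\|=\|X\| \text{ and } \lim_{n\to\infty}\langle Xx_n,x_n\rangle=\lambda\}$. A pair $(U_1,U_2)$ of commuting unitaries on $\mathcal{K}\supseteq\mathcal{H}$ dilates a commuting pair of contractions $(T_1,T_2)$ on $\mathcal{H}$ (is a unitary dilation of it) if $T_1^{n_1}T_2^{n_2}=P_{\mathcal{H}}U_1^{n_1}U_2^{n_2}|_{\mathcal{H}}$ for all integers $n_1,n_2\ge 0$, where $P_{\mathcal{H}}:\mathcal{K}\to\mathcal{H}$ is the orthogonal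 projection. *)

theory Defs
  imports "HOL-Analysis.Analysis"
begin

section \<open>Complex Hilbert spaces\<close>

text \<open>The distribution only has real inner product spaces. A complex inner product space is a real
  one (with its norm, metric and topology) carrying a compatible complex structure; \<open>cinner\<close> is linear
  in its first argument.\<close>

class complex_inner = real_inner +
  fixes scaleC :: "complex \<Rightarrow> 'a \<Rightarrow> 'a"  (infixr \<open>*\<^sub>C\<close> 75)
    and cinner :: "'a \<Rightarrow> 'a \<Rightarrow> complex"
  assumes scaleC_add_right: "c *\<^sub>C (x + y) = c *\<^sub>C x + c *\<^sub>C y"
    and scaleC_add_left: "(c + d) *\<^sub>C x = c *\<^sub>C x + d *\<^sub>C x"
    and scaleC_scaleC: "c *\<^sub>C d *\<^sub>C x = (c * d) *\<^sub>C x"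
    and scaleC_one: "1 *\<^sub>C x = x"
    and scaleR_scaleC: "r *\<^sub>R x = complex_of_real r *\<^sub>C x"
    and cinner_commute: "cinner x y = cnj (cinner y x)"
    and cinner_add_left: "cinner (x + y) z = cinner x z + cinner y z"
    and cinner_scaleC_left: "cinner (c *\<^sub>C x) y = c * cinner x y"
    and inner_eq_Re_cinner: "inner x y = Re (cinner x y)"

text \<open>\<open>polish_space\<close> adds completeness and second countability, which for a metric space is
  separability.\<close>

class separable_hilbert = complex_inner + polish_space

lemma cinner_add_right: "cinner x (y + z) = cinner x y + cinner x z"
  by (metis cinner_add_left cinner_commute complex_cnj_add)

lemma cinner_scaleC_right: "cinner x (c *\<^sub>C y) = cnj c * cinner x y"
  by (metis cinner_commute cinner_scaleC_left complex_cnj_mult)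

lemma cinner_self: "cinner x x = complex_of_real ((norm x)\<^sup>2)"
proof -
  have "Im (cinner x x) = 0"
    by (metis cinner_commute cnj.simps(2) equal_neg_zero)
  moreover have "Re (cinner x x) = (norm x)\<^sup>2"
    by (metis inner_eq_Re_cinner power2_norm_eq_inner)
  ultimately show ?thesis
    by (simp add: complex_eq_iff)
qed

lemma norm_scaleC: "norm (c *\<^sub>C x) = cmod c * norm x"
proof -
  have "complex_of_real ((norm (c *\<^sub>C x))\<^sup>2) = complex_of_real ((cmod c * norm x)\<^sup>2)"
    unfolding cinner_self[symmetric] cinner_scaleC_left cinner_scaleC_right
    by (simp add: cinner_self power_mult_distrib complex_norm_square[unfolded of_real_power] mult_ac)
  then show ?thesis
    by (simp only: of_real_eq_iff power2_eq_iff_nonneg norm_ge_zero mult_nonneg_nonneg)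
qed

lemma norm_cinner_le: "cmod (cinner x y) \<le> norm x * norm y"
proof -
  define c where "c = cnj (sgn (cinner x y))"
  have c: "cmod c \<le> 1"
    by (simp add: c_def norm_sgn)
  have "c * cinner x y = complex_of_real (cmod (cinner x y))"
  proof (cases "cinner x y = 0")
    case False
    have "c * cinner x y = cinner x y * cnj (cinner x y) / complex_of_real (cmod (cinner x y))"
      by (simp add: c_def sgn_eq)
    also have "\<dots> = complex_of_real (cmod (cinner x y))"
      using False by (simp add: complex_norm_square[symmetric] power2_eq_square)
    finally show ?thesis .
  qed simp
  then have "cmod (cinner x y) = inner (c *\<^sub>C x) y"
    by (simp add: inner_eq_Re_cinner cinner_scaleC_left)
  also have "\<dots> \<le> norm (c *\<^sub>C x) * norm y"
    by (rule norm_cauchy_schwarz)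
  also have "\<dots> \<le> norm x * norm y"
    using c by (simp add: norm_scaleC mult_le_cancel_right1 mult_right_mono mult_left_le_one_le)
  finally show ?thesis .
qed

section \<open>Operators\<close>

definition bounded_clinear :: "('a::complex_inner \<Rightarrow> 'b::complex_inner) \<Rightarrow> bool" where
  "bounded_clinear f \<longleftrightarrow> bounded_linear f \<and> (\<forall>c x. f (c *\<^sub>C x) = c *\<^sub>C f x)"

definition contraction :: "('a::complex_inner \<Rightarrow> 'a) \<Rightarrow> bool" where
  "contraction T \<longleftrightarrow> bounded_clinear T \<and> onorm T \<le> 1"

definition cadjoint :: "('a::complex_inner \<Rightarrow> 'a) \<Rightarrow> 'a \<Rightarrow> 'a" where
  "cadjoint T = (THE T'. \<forall>x y. cinner (T x) y = cinner x (T' y))"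

definition positive_op :: "('a::complex_inner \<Rightarrow> 'a) \<Rightarrow> bool" where
  "positive_op A \<longleftrightarrow> bounded_clinear A \<and> (\<forall>x. cinner (A x) x \<in> \<real>\<^sub>\<ge>\<^sub>0)"

definition sqrt_op :: "('a::complex_inner \<Rightarrow> 'a) \<Rightarrow> 'a \<Rightarrow> 'a" where
  "sqrt_op A = (THE B. positive_op B \<and> B \<circ> B = A)"

text \<open>The defect operators \<open>D\<^sub>R = (I - R\<^sup>*R)\<^sup>1\<^sup>/\<^sup>2\<close> and \<open>D\<^sub>R\<^sub>* = (I - RR\<^sup>*)\<^sup>1\<^sup>/\<^sup>2\<close>.\<close>

definition defect :: "('a::complex_inner \<Rightarrow> 'a) \<Rightarrow> 'a \<Rightarrow> 'a" where
  "defect R = sqrt_op (\<lambda>x. x - cadjoint R (R x))"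

definition defect_star :: "('a::complex_inner \<Rightarrow> 'a) \<Rightarrow> 'a \<Rightarrow> 'a" where
  "defect_star R = sqrt_op (\<lambda>x. x - R (cadjoint R x))"

definition maximal_numerical_range :: "('a::complex_inner \<Rightarrow> 'a) \<Rightarrow> complex set" where
  "maximal_numerical_range X =
    {l. \<exists>x :: nat \<Rightarrow> 'a. (\<forall>n. norm (x n) = 1) \<and>
          (\<lambda>n. norm (X (x n))) \<longlonglongrightarrow> onorm X \<and>
          (\<lambda>n. cinner (X (x n)) (x n)) \<longlonglongrightarrow> l}"

section \<open>Operators on a closed subspace\<close>

text \<open>A Hilbert space that is quantified existentially cannot be a type. It is represented by a
  closed subspace \<open>K\<close> of an ambient Hilbert space type, and an operator on it by a function whose
  values outside \<open>K\<close> are irrelevant. The whole type is the case \<open>K = UNIV\<close>. Up to unitary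
  equivalence, the closed subspaces of a separable infinite-dimensional Hilbert space are exactly
  the separable Hilbert spaces.\<close>

definition closed_csubspace :: "'a::complex_inner set \<Rightarrow> bool" where
  "closed_csubspace K \<longleftrightarrow> closed K \<and> 0 \<in> K \<and> (\<forall>x\<in>K. \<forall>y\<in>K. x + y \<in> K) \<and> (\<forall>c. \<forall>x\<in>K. c *\<^sub>C x \<in> K)"

definition bounded_clinear_on :: "'a::complex_inner set \<Rightarrow> ('a \<Rightarrow> 'a) \<Rightarrow> bool" where
  "bounded_clinear_on K f \<longleftrightarrow>
    f ` K \<subseteq> K \<and>
    (\<forall>x\<in>K. \<forall>y\<in>K. f (x + y) = f x + f y) \<and>
    (\<forall>c. \<forall>x\<in>K. f (c *\<^sub>C x) = c *\<^sub>C f x) \<and>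
    (\<exists>B. \<forall>x\<in>K. norm (f x) \<le> norm x * B)"

definition onorm_on :: "'a::complex_inner set \<Rightarrow> ('a \<Rightarrow> 'a) \<Rightarrow> real" where
  "onorm_on K f = (SUP x\<in>K. norm (f x) / norm x)"

definition unitary_on :: "'a::complex_inner set \<Rightarrow> ('a \<Rightarrow> 'a) \<Rightarrow> bool" where
  "unitary_on K U \<longleftrightarrow>
    bounded_clinear_on K U \<and> U ` K = K \<and> (\<forall>x\<in>K. \<forall>y\<in>K. cinner (U x) (U y) = cinner x y)"

definition bj_orthogonal_on :: "'a::complex_inner set \<Rightarrow> ('a \<Rightarrow> 'a) \<Rightarrow> ('a \<Rightarrow> 'a) \<Rightarrow> bool" where
  "bj_orthogonal_on K X Y \<longleftrightarrow> (\<forall>l. onorm_on K (\<lambda>x. X x + l *\<^sub>C Y x) \<ge> onorm_on K X)"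

lemma bounded_clinear_on_UNIV: "bounded_clinear_on UNIV f \<longleftrightarrow> bounded_clinear f"
proof
  assume f: "bounded_clinear_on UNIV f"
  then have "\<And>r x. f (r *\<^sub>R x) = r *\<^sub>R f x"
    by (simp add: bounded_clinear_on_def scaleR_scaleC)
  moreover obtain B where "\<And>x. norm (f x) \<le> norm x * B"
    using f unfolding bounded_clinear_on_def by auto
  ultimately have "bounded_linear f"
    using f by (intro bounded_linear_intro) (auto simp: bounded_clinear_on_def)
  then show "bounded_clinear f"
    using f by (simp add: bounded_clinear_on_def bounded_clinear_def)
next
  assume "bounded_clinear f"
  then show "bounded_clinear_on UNIV f"
    by (auto simp: bounded_clinear_on_def bounded_clinear_def bounded_linear.bounded linear_add
        bounded_linear.linear)
qed

lemma onorm_on_UNIV: "onorm_on UNIV f = onorm f"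
  by (simp add: onorm_on_def onorm_def)

section \<open>Unitary dilations\<close>

definition orth_proj :: "'a::complex_inner set \<Rightarrow> 'a \<Rightarrow> 'a" where
  "orth_proj M x = (THE y. y \<in> M \<and> (\<forall>z\<in>M. cinner (x - y) z = 0))"

text \<open>The inclusion of the space of \<open>T1\<close>, \<open>T2\<close> into \<open>K\<close> is an isometry \<open>J\<close>, and this space is identified
  with the range of \<open>J\<close>.\<close>

definition unitary_dilation ::
    "'b::complex_inner set \<Rightarrow> ('a::complex_inner \<Rightarrow> 'b) \<Rightarrow>
     ('b \<Rightarrow> 'b) \<Rightarrow> ('b \<Rightarrow> 'b) \<Rightarrow> ('a \<Rightarrow> 'a) \<Rightarrow> ('a \<Rightarrow> 'a) \<Rightarrow> bool" where
  "unitary_dilation K J U1 U2 T1 T2 \<longleftrightarrow>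
    closed_csubspace K \<and>
    bounded_clinear J \<and> range J \<subseteq> K \<and> (\<forall>x y. cinner (J x) (J y) = cinner x y) \<and>
    unitary_on K U1 \<and> unitary_on K U2 \<and> (\<forall>k\<in>K. U1 (U2 k) = U2 (U1 k)) \<and>
    (\<forall>n1 n2 x. J ((T1 ^^ n1) ((T2 ^^ n2) x)) =
                 orth_proj (range J) ((U1 ^^ n1) ((U2 ^^ n2) (J x))))"

section \<open>The Hilbert sum over the integers\<close>

lemma square_summable_add:
  fixes f g :: "'i \<Rightarrow> 'a::real_inner"
  assumes "(\<lambda>n. (norm (f n))\<^sup>2) summable_on A" "(\<lambda>n. (norm (g n))\<^sup>2) summable_on A"
  shows "(\<lambda>n. (norm (f n + g n))\<^sup>2) summable_on A"
proof (rule summable_on_comparison_test)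
  show "(\<lambda>n. 2 * (norm (f n))\<^sup>2 + 2 * (norm (g n))\<^sup>2) summable_on A"
    by (intro summable_on_add summable_on_cmult_right assms)
  fix n
  have "(norm (f n + g n))\<^sup>2 \<le> (norm (f n) + norm (g n))\<^sup>2"
    by (simp add: norm_triangle_ineq power_mono)
  also have "\<dots> \<le> 2 * (norm (f n))\<^sup>2 + 2 * (norm (g n))\<^sup>2"
    using sum_squares_bound[of "norm (f n)" "norm (g n)"] by (simp add: power2_sum)
  finally show "(norm (f n + g n))\<^sup>2 \<le> 2 * (norm (f n))\<^sup>2 + 2 * (norm (g n))\<^sup>2" .
qed auto

lemma square_summable_scaleC:
  fixes f :: "'i \<Rightarrow> 'a::complex_inner"
  assumes "(\<lambda>n. (norm (f n))\<^sup>2) summable_on A"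
  shows "(\<lambda>n. (norm (c *\<^sub>C f n))\<^sup>2) summable_on A"
  by (simp add: norm_scaleC power_mult_distrib summable_on_cmult_right assms)

lemma summable_on_cinner:
  fixes f g :: "'i \<Rightarrow> 'a::complex_inner"
  assumes "(\<lambda>n. (norm (f n))\<^sup>2) summable_on A" "(\<lambda>n. (norm (g n))\<^sup>2) summable_on A"
  shows "(\<lambda>n. cinner (f n) (g n)) summable_on A"
proof (rule abs_summable_summable, rule summable_on_comparison_test)
  show "(\<lambda>n. (norm (f n))\<^sup>2 + (norm (g n))\<^sup>2) summable_on A"
    by (intro summable_on_add assms)
  fix n
  have "2 * (norm (f n) * norm (g n)) \<le> (norm (f n))\<^sup>2 + (norm (g n))\<^sup>2"
    using sum_squares_bound[of "norm (f n)" "norm (g n)"] by simp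
  then show "cmod (cinner (f n) (g n)) \<le> (norm (f n))\<^sup>2 + (norm (g n))\<^sup>2"
    using norm_cinner_le[of "f n" "g n"] mult_nonneg_nonneg[OF norm_ge_zero norm_ge_zero, of "f n" "g n"]
    by linarith
qed auto

typedef (overloaded) 'a hsum =
  "{h :: int \<Rightarrow> 'a::complex_inner. (\<lambda>n. (norm (h n))\<^sup>2) summable_on UNIV}"
  morphisms component Abs_hsum
  by (rule exI[of _ "\<lambda>_. 0"]) simp

setup_lifting type_definition_hsum

lemma summable_component: "(\<lambda>n. (norm (component h n))\<^sup>2) summable_on UNIV"
  using component[of h] by simp

instantiation hsum :: (complex_inner) real_inner
begin

lift_definition zero_hsum :: "'a hsum" is "\<lambda>_. 0"
  by simp
lift_definition plus_hsum :: "'a hsum \<Rightarrow> 'a hsum \<Rightarrow> 'a hsum" is "\<lambda>h k n. h n + k n"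
  by (rule square_summable_add)
lift_definition scaleR_hsum :: "real \<Rightarrow> 'a hsum \<Rightarrow> 'a hsum" is "\<lambda>r h n. r *\<^sub>R h n"
  unfolding scaleR_scaleC by (rule square_summable_scaleC)
lift_definition uminus_hsum :: "'a hsum \<Rightarrow> 'a hsum" is "\<lambda>h n. - h n"
  by simp
lift_definition minus_hsum :: "'a hsum \<Rightarrow> 'a hsum \<Rightarrow> 'a hsum" is "\<lambda>h k n. h n - k n"
  unfolding diff_conv_add_uminus by (rule square_summable_add) simp_all
definition inner_hsum :: "'a hsum \<Rightarrow> 'a hsum \<Rightarrow> real" where
  "inner h k = (\<Sum>\<^sub>\<infinity>n. inner (component h n) (component k n))"
definition norm_hsum :: "'a hsum \<Rightarrow> real" where
  "norm h = sqrt (inner h h)" for h :: "'a hsum"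
definition sgn_hsum :: "'a hsum \<Rightarrow> 'a hsum" where
  "sgn h = inverse (norm h) *\<^sub>R h" for h :: "'a hsum"
definition dist_hsum :: "'a hsum \<Rightarrow> 'a hsum \<Rightarrow> real" where
  "dist h k = norm (h - k)" for h k :: "'a hsum"
definition uniformity_hsum :: "('a hsum \<times> 'a hsum) filter" where
  "uniformity_hsum = (INF e\<in>{0<..}. principal {(x, y). dist (x::'a hsum) y < e})"
definition open_hsum :: "'a hsum set \<Rightarrow> bool" where
  "open S \<longleftrightarrow> (\<forall>x\<in>S. \<forall>\<^sub>F (x', y) in uniformity. x' = x \<longrightarrow> y \<in> S)" for S :: "'a hsum set"

lemma inner_hsum_self: "inner h h = (\<Sum>\<^sub>\<infinity>n. (norm (component h n))\<^sup>2)" for h :: "'a hsum"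
  by (simp add: inner_hsum_def power2_norm_eq_inner)

instance
proof
  fix x y z :: "'a hsum" and a b :: real
  show "x + y + z = x + (y + z)" by transfer (simp add: add_ac)
  show "x + y = y + x" by transfer (simp add: add_ac)
  show "0 + x = x" by transfer simp
  show "- x + x = 0" by transfer simp
  show "x - y = x + - y" by transfer simp
  show "a *\<^sub>R (x + y) = a *\<^sub>R x + a *\<^sub>R y" by transfer (simp add: scaleR_add_right)
  show "(a + b) *\<^sub>R x = a *\<^sub>R x + b *\<^sub>R x" by transfer (simp add: scaleR_add_left)
  show "a *\<^sub>R b *\<^sub>R x = (a * b) *\<^sub>R x" by transfer simp
  show "1 *\<^sub>R x = x" by transfer simp
  show "dist x y = norm (x - y)" by (rule dist_hsum_def)
  show "sgn x = inverse (norm x) *\<^sub>R x" by (rule sgn_hsum_def)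
  show "uniformity = (INF e\<in>{0<..}. principal {(x::'a hsum, y). dist x y < e})"
    by (rule uniformity_hsum_def)
  show "open U \<longleftrightarrow> (\<forall>x\<in>U. \<forall>\<^sub>F (x', y) in uniformity. x' = x \<longrightarrow> y \<in> U)" for U :: "'a hsum set"
    by (rule open_hsum_def)
  show "norm x = sqrt (inner x x)" by (rule norm_hsum_def)
  have summable: "(\<lambda>n. inner (component x n) (component y n)) summable_on UNIV" for x y :: "'a hsum"
    unfolding inner_eq_Re_cinner by (intro summable_on_Re summable_on_cinner summable_component)
  show "inner x y = inner y x"
    by (simp add: inner_hsum_def inner_commute)
  show "inner (x + y) z = inner x z + inner y z"
    by (simp add: inner_hsum_def plus_hsum.rep_eq inner_add_left infsum_add summable)
  show "inner (a *\<^sub>R x) y = a * inner x y"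
    by (simp add: inner_hsum_def scaleR_hsum.rep_eq infsum_cmult_right summable)
  show "0 \<le> inner x x"
    unfolding inner_hsum_self by (intro infsum_nonneg) simp
  show "inner x x = 0 \<longleftrightarrow> x = 0"
  proof
    assume "inner x x = 0"
    then have "(norm (component x n))\<^sup>2 = 0" for n
      unfolding inner_hsum_self
      by (intro nonneg_infsum_le_0D[where A = UNIV] summable_component) auto
    then show "x = 0"
      by (simp add: component_inject[symmetric] zero_hsum.rep_eq fun_eq_iff)
  qed (simp add: inner_hsum_self zero_hsum.rep_eq)
qed

end

instantiation hsum :: (complex_inner) complex_inner
begin

lift_definition scaleC_hsum :: "complex \<Rightarrow> 'a hsum \<Rightarrow> 'a hsum" is "\<lambda>c h n. c *\<^sub>C h n"
  by (rule square_summable_scaleC)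
definition cinner_hsum :: "'a hsum \<Rightarrow> 'a hsum \<Rightarrow> complex" where
  "cinner h k = (\<Sum>\<^sub>\<infinity>n. cinner (component h n) (component k n))"

instance
proof
  fix x y z :: "'a hsum" and a :: real and c d :: complex
  show "c *\<^sub>C (x + y) = c *\<^sub>C x + c *\<^sub>C y" by transfer (simp add: scaleC_add_right)
  show "(c + d) *\<^sub>C x = c *\<^sub>C x + d *\<^sub>C x" by transfer (simp add: scaleC_add_left)
  show "c *\<^sub>C d *\<^sub>C x = (c * d) *\<^sub>C x" by transfer (simp add: scaleC_scaleC)
  show "1 *\<^sub>C x = x" by transfer (simp add: scaleC_one)
  show "a *\<^sub>R x = complex_of_real a *\<^sub>C x" by transfer (simp add: scaleR_scaleC)
  show "cinner x y = cnj (cinner y x)"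
    unfolding cinner_hsum_def infsum_cnj[symmetric]
    by (intro infsum_cong) (rule cinner_commute)
  show "cinner (x + y) z = cinner x z + cinner y z"
    unfolding cinner_hsum_def plus_hsum.rep_eq cinner_add_left
    by (intro infsum_add summable_on_cinner summable_component)
  show "cinner (c *\<^sub>C x) y = c * cinner x y"
    unfolding cinner_hsum_def scaleC_hsum.rep_eq cinner_scaleC_left
    by (intro infsum_cmult_right summable_on_cinner summable_component)
  show "inner x y = Re (cinner x y)"
    unfolding inner_hsum_def cinner_hsum_def inner_eq_Re_cinner
    by (intro infsum_Re summable_on_cinner summable_component)
qed

end

lemma norm_hsum_square: "(norm h)\<^sup>2 = (\<Sum>\<^sub>\<infinity>n. (norm (component h n))\<^sup>2)"
  by (simp add: power2_norm_eq_inner inner_hsum_self)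

lemma sum_component_le: "finite F \<Longrightarrow> (\<Sum>n\<in>F. (norm (component h n))\<^sup>2) \<le> (norm h)\<^sup>2"
  unfolding norm_hsum_square by (intro finite_sum_le_infsum summable_component) auto

lemma norm_component_le: "norm (component h n) \<le> norm h"
  using sum_component_le[of "{n}" h] by (simp add: power2_le_iff_abs_le)

instance hsum :: (separable_hilbert) complete_space
proof
  fix X :: "nat \<Rightarrow> 'a hsum"
  assume X: "Cauchy X"
  have "Cauchy (\<lambda>k. component (X k) n)" for n
  proof (rule metric_CauchyI)
    fix e :: real assume "0 < e"
    then obtain M where M: "\<And>k l. k \<ge> M \<Longrightarrow> l \<ge> M \<Longrightarrow> dist (X k) (X l) < e"
      using metric_CauchyD[OF X] by blast
    have "dist (component (X k) n) (component (X l) n) < e" if "k \<ge> M" "l \<ge> M" for k l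
      using M[OF that] norm_component_le[of "X k - X l" n]
      by (simp add: dist_norm minus_hsum.rep_eq)
    then show "\<exists>M. \<forall>k\<ge>M. \<forall>l\<ge>M. dist (component (X k) n) (component (X l) n) < e"
      by blast
  qed
  then have "\<forall>n. \<exists>l. (\<lambda>k. component (X k) n) \<longlonglongrightarrow> l"
    by (simp add: Cauchy_convergent_iff convergent_def)
  then obtain h where h: "\<And>n. (\<lambda>k. component (X k) n) \<longlonglongrightarrow> h n"
    by metis
  have tail: "\<exists>M. \<forall>k\<ge>M. \<forall>F. finite F \<longrightarrow> (\<Sum>n\<in>F. (norm (component (X k) n - h n))\<^sup>2) \<le> e\<^sup>2"
    if e: "0 < e" for e
  proof -
    obtain M where M: "\<And>k l. k \<ge> M \<Longrightarrow> l \<ge> M \<Longrightarrow> dist (X k) (X l) < e"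
      using metric_CauchyD[OF X e] by blast
    have "(\<Sum>n\<in>F. (norm (component (X k) n - h n))\<^sup>2) \<le> e\<^sup>2" if k: "k \<ge> M" and F: "finite F" for k F
    proof (rule tendsto_upperbound)
      show "(\<lambda>l. \<Sum>n\<in>F. (norm (component (X k) n - component (X l) n))\<^sup>2)
              \<longlonglongrightarrow> (\<Sum>n\<in>F. (norm (component (X k) n - h n))\<^sup>2)"
        by (intro tendsto_intros h)
      have "(\<Sum>n\<in>F. (norm (component (X k) n - component (X l) n))\<^sup>2) \<le> e\<^sup>2" if "l \<ge> M" for l
      proof -
        have "(\<Sum>n\<in>F. (norm (component (X k) n - component (X l) n))\<^sup>2) \<le> (norm (X k - X l))\<^sup>2"
          using sum_component_le[OF F, of "X k - X l"] by (simp add: minus_hsum.rep_eq)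
        also have "\<dots> \<le> e\<^sup>2"
          using M[OF k that] by (intro power_mono) (simp_all add: dist_norm)
        finally show ?thesis .
      qed
      then show "\<forall>\<^sub>F l in sequentially. (\<Sum>n\<in>F. (norm (component (X k) n - component (X l) n))\<^sup>2) \<le> e\<^sup>2"
        by (auto simp: eventually_sequentially)
    qed simp
    then show ?thesis by blast
  qed
  have diff: "(\<lambda>n. (norm (component (X k) n - h n))\<^sup>2) summable_on UNIV"
    if "\<forall>F. finite F \<longrightarrow> (\<Sum>n\<in>F. (norm (component (X k) n - h n))\<^sup>2) \<le> B" for k B
    using that by (intro nonneg_bdd_above_summable_on) (auto intro!: bdd_aboveI)
  obtain M where "\<forall>F. finite F \<longrightarrow> (\<Sum>n\<in>F. (norm (component (X M) n - h n))\<^sup>2) \<le> 1\<^sup>2"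
    using tail[of 1] by auto
  then have "(\<lambda>n. (norm (component (X M) n + - (component (X M) n - h n)))\<^sup>2) summable_on UNIV"
    by (intro square_summable_add summable_component)
      (simp only: norm_minus_cancel, rule diff)
  then have sh: "(\<lambda>n. (norm (h n))\<^sup>2) summable_on UNIV"
    by simp
  then have rep: "component (Abs_hsum h) = h"
    by (simp add: Abs_hsum_inverse)
  have "X \<longlonglongrightarrow> Abs_hsum h"
  proof (rule metric_LIMSEQ_I)
    fix e :: real assume e: "0 < e"
    then obtain M where M: "\<forall>k\<ge>M. \<forall>F. finite F \<longrightarrow>
        (\<Sum>n\<in>F. (norm (component (X k) n - h n))\<^sup>2) \<le> (e/2)\<^sup>2"
      using tail[of "e/2"] by auto
    have "dist (X k) (Abs_hsum h) < e" if "k \<ge> M" for k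
    proof -
      have "(norm (X k - Abs_hsum h))\<^sup>2 \<le> (e/2)\<^sup>2"
        unfolding norm_hsum_square minus_hsum.rep_eq rep
        using M that by (intro infsum_le_finite_sums diff[of k "(e/2)\<^sup>2"]) auto
      then have "norm (X k - Abs_hsum h) \<le> e/2"
        using e by (simp add: power2_le_iff_abs_le)
      then show ?thesis
        using e by (simp add: dist_norm)
    qed
    then show "\<exists>M. \<forall>k\<ge>M. dist (X k) (Abs_hsum h) < e" by blast
  qed
  then show "convergent X" by (rule convergentI)
qed

lemma second_countable_if_countable_dense:
  fixes D :: "'a::metric_space set"
  assumes "countable D" "\<And>x e. e > 0 \<Longrightarrow> \<exists>d\<in>D. dist x d < e"
  shows "\<exists>B::'a set set. countable B \<and> open = generate_topology B"
proof -
  define B where "B = (\<lambda>(d, n). ball d (inverse (real (Suc n)))) ` (D \<times> UNIV)"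
  have "countable B"
    unfolding B_def using assms(1) by auto
  moreover have "topological_basis B"
  proof (rule topological_basisI)
    show "open b" if "b \<in> B" for b
      using that by (auto simp: B_def)
    fix S :: "'a set" and x assume "open S" "x \<in> S"
    then obtain e where e: "e > 0" "ball x e \<subseteq> S"
      by (auto simp: open_contains_ball)
    then obtain n where n: "inverse (real (Suc n)) < e / 2"
      using reals_Archimedean[of "e/2"] by auto
    obtain d where d: "d \<in> D" "dist x d < inverse (real (Suc n))"
      using assms(2)[of "inverse (real (Suc n))" x] by auto
    have "ball d (inverse (real (Suc n))) \<subseteq> ball x e"
    proof
      fix z assume "z \<in> ball d (inverse (real (Suc n)))"
      then show "z \<in> ball x e"
        using d n dist_triangle[of x z d] by auto
    qed
    then show "\<exists>b\<in>B. x \<in> b \<and> b \<subseteq> S"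
      using d e by (intro bexI[of _ "ball d (inverse (real (Suc n)))"])
        (auto simp: B_def dist_commute)
  qed
  ultimately show ?thesis
    using topological_basis_imp_subbasis by blast
qed

instance hsum :: (separable_hilbert) second_countable_topology
proof
  obtain C :: "'a set" where C: "countable C" "\<And>X. open X \<Longrightarrow> X \<noteq> {} \<Longrightarrow> \<exists>d\<in>C. d \<in> X"
    using countable_dense_setE by blast
  define pad :: "'a list \<Rightarrow> nat \<Rightarrow> int \<Rightarrow> 'a" where
    "pad xs N n = (if \<bar>n\<bar> \<le> int N \<and> nat (n + int N) < length xs then xs ! nat (n + int N) else 0)"
    for xs N n
  have fin: "finite {n::int. \<bar>n\<bar> \<le> int N}" for N
    by (rule finite_subset[of _ "{- int N..int N}"]) auto
  have pad: "component (Abs_hsum (pad xs N)) = pad xs N" for xs N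
  proof -
    have "(\<lambda>n. (norm (pad xs N n))\<^sup>2) summable_on {n. \<bar>n\<bar> \<le> int N}"
      using fin by simp
    also have "?this \<longleftrightarrow> (\<lambda>n. (norm (pad xs N n))\<^sup>2) summable_on UNIV"
      by (intro summable_on_cong_neutral) (auto simp: pad_def)
    finally show ?thesis by (simp add: Abs_hsum_inverse)
  qed
  define D where "D = (\<lambda>(xs, N). Abs_hsum (pad xs N)) ` (lists C \<times> UNIV)"
  have "countable D"
    unfolding D_def using C(1) by auto
  moreover have "\<exists>d\<in>D. dist h d < e" if e: "e > 0" for h :: "'a hsum" and e
  proof -
    obtain F where F: "finite F"
      "dist (\<Sum>n\<in>F. (norm (component h n))\<^sup>2) (\<Sum>\<^sub>\<infinity>n. (norm (component h n))\<^sup>2) \<le> e\<^sup>2 / 4"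
      using infsum_finite_approximation[OF summable_component, of "e\<^sup>2 / 4" h] e by auto
    have "F \<subseteq> {n. \<bar>n\<bar> \<le> (\<Sum>n\<in>F. \<bar>n\<bar>)}"
      using F(1) by (auto intro: member_le_sum)
    moreover have "int (nat (\<Sum>n\<in>F. \<bar>n\<bar>)) = (\<Sum>n\<in>F. \<bar>n\<bar>)"
      by (simp add: sum_nonneg)
    ultimately obtain N where N: "F \<subseteq> {n. \<bar>n\<bar> \<le> int N}"
      by metis
    define G where "G = {n. \<bar>n\<bar> \<le> int N}"
    have G: "finite G" "F \<subseteq> G" unfolding G_def using N fin by auto
    define r where "r = e / (2 * real (2 * N + 1))"
    have r: "r > 0" using e by (simp add: r_def)
    have "\<exists>c\<in>C. dist x c < r" for x
      using C(2)[of "ball x r"] r by auto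
    then obtain c where c: "\<And>x. c x \<in> C" "\<And>x. dist x (c x) < r"
      by metis
    define xs where "xs = map (\<lambda>i. c (component h (int i - int N))) [0..<2 * N + 1]"
    have xs: "pad xs N n = (if n \<in> G then c (component h n) else 0)" for n
      by (auto simp: pad_def xs_def G_def simp del: upt_Suc)
    define d where "d = Abs_hsum (pad xs N)"
    have "xs \<in> lists C"
      using c by (auto simp: xs_def)
    then have dD: "d \<in> D"
      unfolding d_def D_def by auto
    let ?f = "\<lambda>n. (norm (component h n))\<^sup>2" and ?g = "\<lambda>n. (norm (component (h - d) n))\<^sup>2"
    have cg: "component (h - d) n = component h n - (if n \<in> G then c (component h n) else 0)" for n
      by (simp add: minus_hsum.rep_eq d_def pad xs)
    have "(norm (h - d))\<^sup>2 = infsum ?g (G \<union> - G)"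
      by (simp add: norm_hsum_square)
    also have "\<dots> = infsum ?g G + infsum ?g (- G)"
      using G summable_component[of "h - d"]
      by (intro infsum_Un_disjoint) (auto intro: summable_on_subset_banach)
    also have "infsum ?g (- G) = infsum ?f (- G)"
      by (intro infsum_cong) (simp add: cg)
    also have "\<dots> = infsum ?f UNIV - sum ?f G"
    proof -
      have "?f summable_on - G"
        by (rule summable_on_subset_banach[OF summable_component]) simp
      then show ?thesis
        using infsum_Un_disjoint[of ?f G "- G"] G by simp
    qed
    also have "\<dots> \<le> e\<^sup>2 / 4"
      using F(2) sum_mono2[OF G, of ?f] finite_sum_le_infsum[OF summable_component F(1), of h]
      by (auto simp: dist_real_def)
    also have "infsum ?g G = (\<Sum>n\<in>G. (norm (component h n - c (component h n)))\<^sup>2)"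
      using G by (simp add: cg)
    also have "\<dots> \<le> (\<Sum>n\<in>G. r\<^sup>2)"
      using c(2) by (intro sum_mono power_mono) (auto simp: dist_norm less_imp_le)
    also have "\<dots> = real (card G) * r\<^sup>2"
      by simp
    also have "card G = 2 * N + 1"
    proof -
      have "G = {- int N..int N}" by (auto simp: G_def)
      then show ?thesis by simp
    qed
    also have "real (2 * N + 1) * r\<^sup>2 \<le> (real (2 * N + 1))\<^sup>2 * r\<^sup>2"
      by (intro mult_right_mono) (simp_all add: power2_eq_square)
    also have "\<dots> = (e / 2)\<^sup>2"
    proof -
      have "real (2 * N + 1) * r = e / 2"
        using mult_divide_mult_cancel_left[of "real (2 * N + 1)" e 2]
        by (simp only: r_def times_divide_eq_right mult.commute[of 2])
      then show ?thesis
        by (simp only: power_mult_distrib[symmetric])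
    qed
    also have "\<dots> = e\<^sup>2 / 4"
      by (simp add: power2_eq_square)
    finally have "(norm (h - d))\<^sup>2 \<le> e\<^sup>2 / 2"
      by simp
    also have "\<dots> < e\<^sup>2"
      using e by simp
    finally have "dist h d < e"
      using e by (simp add: dist_norm power_less_imp_less_base)
    then show ?thesis
      using dD by blast
  qed
  ultimately show "\<exists>B::'a hsum set set. countable B \<and> open = generate_topology B"
    by (rule second_countable_if_countable_dense)
qed

instance hsum :: (separable_hilbert) separable_hilbert ..

section \<open>The Schaeffer dilation\<close>

lift_definition schaeffer :: "('a::complex_inner \<Rightarrow> 'a) \<Rightarrow> 'a hsum \<Rightarrow> 'a hsum" is
  "\<lambda>R h n. if n = -1 then defect R (h 0) - cadjoint R (h 1)
           else if n = 0 then R (h 0) + defect_star R (h 1)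
           else h (n + 1)"
proof -
  fix R :: "'a \<Rightarrow> 'a" and h :: "int \<Rightarrow> 'a"
  let ?k = "\<lambda>n. if n = -1 then defect R (h 0) - cadjoint R (h 1)
           else if n = 0 then R (h 0) + defect_star R (h 1) else h (n + 1)"
  assume "(\<lambda>n. (norm (h n))\<^sup>2) summable_on UNIV"
  then have "(\<lambda>n. (norm (h (n + 1)))\<^sup>2) summable_on UNIV"
    using summable_on_reindex_bij_betw[of "\<lambda>n. n + 1" UNIV UNIV "\<lambda>n. (norm (h n))\<^sup>2"]
    by (auto simp: bij_plus_right)
  then have "(\<lambda>n. (norm (h (n + 1)))\<^sup>2) summable_on (UNIV - {-1, 0})"
    by (rule summable_on_subset_banach) simp
  also have "?this \<longleftrightarrow> (\<lambda>n. (norm (?k n))\<^sup>2) summable_on (UNIV - {-1, 0})"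
    by (intro summable_on_cong) simp
  finally have "(\<lambda>n. (norm (?k n))\<^sup>2) summable_on ((UNIV - {-1, 0}) \<union> {-1, 0})"
    by (intro summable_on_union) auto
  also have "(UNIV - {-1, 0}) \<union> {-1, 0} = (UNIV :: int set)"
    by blast
  finally show "(\<lambda>n. (norm (?k n))\<^sup>2) summable_on UNIV" .
qed

end

theory Submission
  imports Defs
begin

text \<open>Let \<open>U\<close> and \<open>V\<close> be unitaries. By \<open>bj_orthogonal_unitaries\<close>, \<open>U \<bottom>\<^sub>B V\<close> holds as soon as the
  form \<open>\<langle>U h, V h\<rangle>\<close> tends to some \<open>l \<le> 0\<close> along unit vectors \<open>x\<^sub>n\<close> and there is a unit vector \<open>z\<close> with
  \<open>U z = V z\<close> in a suitably orthogonal position: a fixed combination \<open>a x\<^sub>n + b z\<close> then makes the form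
  tend to \<open>0\<close>, so that \<open>\<parallel>(U + m V) h\<parallel>\<^sup>2\<close> comes arbitrarily close to \<open>1 + \<bar>m\<bar>\<^sup>2\<close>.

  For (i), \<open>T\<close> and \<open>ST\<close> have the same defect operator because \<open>S\<close> is unitary. On a vector \<open>y\<close> placed at
  index \<open>0\<close> the form of the two Schaeffer dilations is therefore
  \<open>\<parallel>D\<^sub>T y\<parallel>\<^sup>2 + \<langle>T y, S T y\<rangle> = 1 - \<parallel>T y\<parallel>\<^sup>2 + \<langle>T y, S T y\<rangle>\<close>, the quantity of the hypothesis, while on
  indices \<open>n \<ge> 2\<close> the two dilations are the same shift and provide \<open>z\<close>.

  For (ii), \<open>\<Oplus> S\<close> commutes with the Schaeffer dilation \<open>W\<close> of \<open>T\<close>, since \<open>S\<close> commutes with \<open>T\<close>, \<open>T\<^sup>*\<close> and both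
  defect operators. So \<open>W\<close> and \<open>(\<Oplus> S) W\<close> form a unitary dilation of \<open>(T, ST)\<close>. Their form takes values
  near the given point of the numerical range of \<open>S\<close>, but \<open>z\<close> is missing; it is supplied by adding the
  identity as a direct summand to both, which keeps the pair a dilation. A Hilbert sum over the
  integers splits into its even and its odd part, so the enlarged pair acts on the same space.

  Both parts rest on the Schaeffer operator being unitary (\<open>unitary_schaeffer\<close>). This needs adjoints,
  obtained from the Riesz theorem, the existence and uniqueness of positive square roots of \<open>I - C\<close> for
  a self-adjoint contraction \<open>C\<close> (\<open>sqrt_op_eq\<close>), and the intertwining \<open>T D\<^sub>T = D\<^sub>T\<^sub>* T\<close>. The root is the limit of
  an iteration in \<open>C\<close>, and one lemma on this limit (\<open>root_lim_intertwines\<close>) yields its uniqueness, the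
  intertwining, and the commutation of \<open>S\<close> with the defect operators.\<close>

section \<open>Complex inner products\<close>

lemma cinner_zero_left [simp]: "cinner 0 y = 0"
  using cinner_add_left[of 0 0 y] by simp

lemma cinner_zero_right [simp]: "cinner x 0 = 0"
  using cinner_add_right[of x 0 0] by simp

lemma cinner_minus_left [simp]: "cinner (- x) y = - cinner x y"
  using cinner_add_left[of x "- x" y] by (simp add: eq_neg_iff_add_eq_0 add.commute)

lemma cinner_minus_right [simp]: "cinner x (- y) = - cinner x y"
  using cinner_add_right[of x y "- y"] by (simp add: eq_neg_iff_add_eq_0 add.commute)

lemma cinner_diff_left: "cinner (x - y) z = cinner x z - cinner y z"
  using cinner_add_left[of x "- y" z] by simp

lemma cinner_diff_right: "cinner x (y - z) = cinner x y - cinner x z"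
  using cinner_add_right[of x y "- z"] by simp

lemma cinner_scaleR_left [simp]: "cinner (r *\<^sub>R x) y = complex_of_real r * cinner x y"
  by (simp add: scaleR_scaleC cinner_scaleC_left)

lemma cinner_scaleR_right [simp]: "cinner x (r *\<^sub>R y) = complex_of_real r * cinner x y"
  by (simp add: scaleR_scaleC cinner_scaleC_right)

lemmas cinner_linear = cinner_add_left cinner_add_right cinner_diff_left cinner_diff_right

lemma scaleC_zero_right [simp]: "c *\<^sub>C 0 = (0 :: 'a::complex_inner)"
  using scaleC_add_right[of c 0 "0 :: 'a"] by simp

lemma scaleC_diff_right: "c *\<^sub>C (x - y) = c *\<^sub>C x - c *\<^sub>C y"
  using scaleC_add_right[of c "x - y" y] by (simp add: algebra_simps)

lemma scaleC_scaleR_commute: "c *\<^sub>C r *\<^sub>R x = r *\<^sub>R c *\<^sub>C x"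
  by (simp add: scaleR_scaleC scaleC_scaleC mult.commute)

lemma bounded_linear_scaleC: "bounded_linear (\<lambda>x. c *\<^sub>C x)"
  by (rule bounded_linear_intro[where K = "cmod c"])
     (auto simp: scaleC_add_right scaleC_scaleR_commute norm_scaleC)

text \<open>Operators are identified below through their sesquilinear forms; this is how identities
  between adjoints are obtained.\<close>

lemma cinner_ext_right:
  assumes "\<And>z. cinner z x = cinner z y"
  shows "x = y"
proof -
  have "cinner (x - y) (x - y) = 0"
    using assms by (simp add: cinner_diff_right)
  then show ?thesis
    by (simp add: cinner_self)
qed

lemma cinner_ext_left:
  assumes "\<And>z. cinner x z = cinner y z"
  shows "x = y"
  by (rule cinner_ext_right) (metis assms cinner_commute)

lemma cinner_eq_zero_commute: "cinner x y = 0 \<longleftrightarrow> cinner y x = 0"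
  by (metis cinner_commute complex_cnj_zero)

lemma norm_eq_if_cinner_eq:
  assumes "cinner x x = cinner y y"
  shows "norm x = norm y"
proof -
  have "(norm x)\<^sup>2 = (norm y)\<^sup>2"
    using assms unfolding cinner_self by (simp only: of_real_eq_iff)
  then show ?thesis
    by (simp add: power2_eq_iff_nonneg)
qed

lemma bounded_clinear_bounded_linear: "bounded_clinear f \<Longrightarrow> bounded_linear f"
  by (simp add: bounded_clinear_def)

lemma bounded_clinear_add: "bounded_clinear f \<Longrightarrow> f (x + y) = f x + f y"
  by (simp add: bounded_clinear_def linear_add bounded_linear.linear)

lemma bounded_clinear_diff: "bounded_clinear f \<Longrightarrow> f (x - y) = f x - f y"
  by (simp add: bounded_clinear_def linear_diff bounded_linear.linear)

lemma bounded_clinear_zero: "bounded_clinear f \<Longrightarrow> f 0 = 0"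
  by (simp add: bounded_clinear_def linear_0 bounded_linear.linear)

lemma bounded_clinear_scaleC: "bounded_clinear f \<Longrightarrow> f (c *\<^sub>C x) = c *\<^sub>C f x"
  by (simp add: bounded_clinear_def)

lemma bounded_clinear_scaleR: "bounded_clinear f \<Longrightarrow> f (r *\<^sub>R x) = r *\<^sub>R f x"
  by (simp add: bounded_clinear_scaleC scaleR_scaleC)

lemma bounded_clinearI:
  assumes "\<And>x y. f (x + y) = f x + f y" "\<And>c x. f (c *\<^sub>C x) = c *\<^sub>C f x"
    and "\<And>x. norm (f x) \<le> norm x * K"
  shows "bounded_clinear f"
  unfolding bounded_clinear_def
  using assms by (auto intro!: bounded_linear_intro[where K = K] simp: scaleR_scaleC)

lemma contraction_norm_le:
  assumes "contraction T"
  shows "norm (T x) \<le> norm x"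
proof -
  have "norm (T x) \<le> onorm T * norm x"
    using assms by (auto simp: contraction_def bounded_clinear_def intro: onorm)
  also have "\<dots> \<le> norm x"
    using assms by (auto simp: contraction_def intro: mult_left_le_one_le onorm_pos_le[OF bounded_clinear_bounded_linear])
  finally show ?thesis .
qed

lemma contraction_bounded_clinear: "contraction T \<Longrightarrow> bounded_clinear T"
  by (simp add: contraction_def)

lemma contractionI:
  assumes "\<And>x y. T (x + y) = T x + T y" "\<And>c x. T (c *\<^sub>C x) = c *\<^sub>C T x"
    and "\<And>x. norm (T x) \<le> norm x"
  shows "contraction T"
  unfolding contraction_def
  using assms by (auto intro!: bounded_clinearI[where K = 1] onorm_bound)

lemma contraction_compose:
  assumes "contraction S" "contraction T"
  shows "contraction (S \<circ> T)"
proof (rule contractionI)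
  show "norm ((S \<circ> T) x) \<le> norm x" for x
    using contraction_norm_le[OF assms(1), of "T x"] contraction_norm_le[OF assms(2), of x] by simp
qed (use assms in \<open>auto simp: contraction_def bounded_clinear_add bounded_clinear_scaleC\<close>)

section \<open>Adjoints\<close>

text \<open>The first variation argument, used at the minimiser in the Riesz theorem and at null vectors of
  a positive form.\<close>

lemma quadratic_nonneg_imp_linear_coeff_zero:
  fixes M N :: real
  assumes "\<And>t. 0 \<le> 2 * t * N + t\<^sup>2 * M"
  shows "N = 0"
proof (rule ccontr)
  assume "N \<noteq> 0"
  define k where "k = \<bar>M\<bar> + 1"
  have k: "k > 0" "M < 2 * k"
    by (auto simp: k_def)
  have "0 \<le> 2 * (- N / k) * N + (- N / k)\<^sup>2 * M"
    by (rule assms)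
  also have "\<dots> = (N\<^sup>2 / k\<^sup>2) * (M - 2 * k)"
    using k by (simp add: field_simps power2_eq_square)
  also have "\<dots> < 0"
    using k \<open>N \<noteq> 0\<close> by (intro mult_pos_neg) auto
  finally show False
    by simp
qed

text \<open>The representing vector is the minimiser of \<open>\<parallel>x\<parallel>\<^sup>2 - 2 f x\<close>: by the parallelogram law a
  minimising sequence is Cauchy, and the first variation at the minimiser vanishes.\<close>

lemma riesz_representation:
  fixes f :: "'a::{real_inner, complete_space} \<Rightarrow> real"
  assumes f: "bounded_linear f"
  shows "\<exists>v. \<forall>x. f x = inner x v"
proof -
  define q where "q x = (norm x)\<^sup>2 - 2 * f x" for x
  note lin = bounded_linear.linear[OF f]
  obtain M where M: "\<And>x. norm (f x) \<le> norm x * M"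
    using bounded_linear.bounded[OF f] by blast
  have "- M\<^sup>2 \<le> q x" for x
  proof -
    have "- M\<^sup>2 \<le> (norm x)\<^sup>2 - 2 * (norm x * M)"
      using zero_le_power2[of "norm x - M"] by (simp add: power2_diff)
    then show ?thesis
      using M[of x] by (simp add: q_def)
  qed
  then have bdd: "bdd_below (range q)"
    by (intro bdd_belowI[of _ "- M\<^sup>2"]) auto
  define m where "m = Inf (range q)"
  have m: "m \<le> q x" for x
    unfolding m_def by (intro cInf_lower bdd) simp
  have "\<exists>x. q x < m + inverse (real (Suc n))" for n
    using cInf_less_iff[OF _ bdd, of "m + inverse (real (Suc n))"] by (auto simp: m_def)
  then obtain X where X: "\<And>n. q (X n) < m + inverse (real (Suc n))"
    by metis
  \<comment> \<open>the parallelogram law; the contributions of the linear functional \<open>f\<close> cancel\<close>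
  have par: "(norm (x - y))\<^sup>2 = 2 * q x + 2 * q y - 4 * q ((1/2) *\<^sub>R (x + y))" for x y
    by (simp add: q_def power2_norm_eq_inner inner_add_left inner_add_right inner_diff_left
        inner_diff_right inner_commute linear_add[OF lin] linear_scale[OF lin] field_simps)
  have "Cauchy X"
  proof (rule metric_CauchyI)
    fix e :: real assume e: "0 < e"
    obtain N where N: "inverse (real (Suc N)) < e\<^sup>2 / 4"
      using reals_Archimedean[of "e\<^sup>2 / 4"] e by auto
    have "dist (X k) (X l) < e" if "k \<ge> N" "l \<ge> N" for k l
    proof -
      have "inverse (real (Suc k)) \<le> inverse (real (Suc N))" "inverse (real (Suc l)) \<le> inverse (real (Suc N))"
        using that by (auto intro!: le_imp_inverse_le)
      then have "(norm (X k - X l))\<^sup>2 < e\<^sup>2"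
        using par[of "X k" "X l"] X[of k] X[of l] m[of "(1/2) *\<^sub>R (X k + X l)"] N by linarith
      then show ?thesis
        using e by (simp add: dist_norm power_less_imp_less_base)
    qed
    then show "\<exists>M. \<forall>k\<ge>M. \<forall>l\<ge>M. dist (X k) (X l) < e"
      by blast
  qed
  then obtain v where v: "X \<longlonglongrightarrow> v"
    using Cauchy_convergent_iff convergent_def by blast
  have "(\<lambda>n. q (X n)) \<longlonglongrightarrow> q v"
    unfolding q_def by (intro tendsto_intros v bounded_linear.tendsto[OF f])
  moreover have "(\<lambda>n. m + inverse (real (Suc n))) \<longlonglongrightarrow> m + 0"
    by (intro tendsto_intros LIMSEQ_inverse_real_of_nat)
  ultimately have "q v \<le> m"
    using LIMSEQ_le[of "\<lambda>n. q (X n)" "q v" "\<lambda>n. m + inverse (real (Suc n))" m] X by (auto intro: less_imp_le)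
  then have min: "q v \<le> q x" for x
    using m order_trans by blast
  have "f x = inner x v" for x
  proof -
    have "0 \<le> 2 * t * (inner x v - f x) + t\<^sup>2 * (norm x)\<^sup>2" for t
    proof -
      have "(norm (v + t *\<^sub>R x))\<^sup>2 = (norm v)\<^sup>2 + 2 * t * inner x v + t\<^sup>2 * (norm x)\<^sup>2"
        unfolding power2_norm_eq_inner
        by (simp add: inner_add_left inner_add_right inner_commute algebra_simps power2_eq_square)
      then show ?thesis
        using min[of "v + t *\<^sub>R x"]
        by (simp add: q_def linear_add[OF lin] linear_scale[OF lin] algebra_simps)
    qed
    then have "inner x v - f x = 0"
      by (rule quadratic_nonneg_imp_linear_coeff_zero)
    then show ?thesis
      by simp
  qed
  then show ?thesis
    by blast
qed

text \<open>The Riesz theorem represents the real functional \<open>x \<mapsto> Re \<langle>T x, y\<rangle>\<close>; replacing \<open>x\<close> by \<open>\<i> x\<close>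
  recovers the imaginary part.\<close>

lemma adjoint_exists:
  fixes T :: "'a::{complex_inner, complete_space} \<Rightarrow> 'a"
  assumes T: "bounded_clinear T"
  shows "\<exists>T'. \<forall>x y. cinner (T x) y = cinner x (T' y)"
proof -
  have "\<exists>v. \<forall>x. cinner (T x) y = cinner x v" for y
  proof -
    have "bounded_linear (\<lambda>x. inner (T x) y)"
      using bounded_linear_compose[OF bounded_linear_inner_left bounded_clinear_bounded_linear[OF T]] by simp
    then obtain v where v: "\<And>x. inner (T x) y = inner x v"
      using riesz_representation by blast
    have "cinner (T x) y = cinner x v" for x
    proof (rule complex_eqI)
      show "Re (cinner (T x) y) = Re (cinner x v)"
        using v[of x] by (simp add: inner_eq_Re_cinner)
      show "Im (cinner (T x) y) = Im (cinner x v)"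
        using v[of "\<i> *\<^sub>C x"]
        by (simp add: inner_eq_Re_cinner bounded_clinear_scaleC[OF T] cinner_scaleC_left)
    qed
    then show ?thesis
      by blast
  qed
  then show ?thesis
    by metis
qed

lemma cinner_cadjoint:
  fixes T :: "'a::{complex_inner, complete_space} \<Rightarrow> 'a"
  assumes "bounded_clinear T"
  shows "cinner x (cadjoint T y) = cinner (T x) y"
proof -
  have "\<exists>!T'. \<forall>x y. cinner (T x) y = cinner x (T' y)"
  proof (rule ex_ex1I)
    fix T' T'' assume "\<forall>x y. cinner (T x) y = cinner x (T' y)" "\<forall>x y. cinner (T x) y = cinner x (T'' y)"
    then show "T' = T''"
      by (intro ext cinner_ext_right) metis
  qed (rule adjoint_exists[OF assms])
  then have "\<forall>x y. cinner (T x) y = cinner x (cadjoint T y)"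
    unfolding cadjoint_def by (rule theI')
  then show ?thesis
    by metis
qed

lemma cinner_cadjoint_left:
  fixes T :: "'a::{complex_inner, complete_space} \<Rightarrow> 'a"
  assumes "bounded_clinear T"
  shows "cinner (cadjoint T x) y = cinner x (T y)"
  by (metis assms cinner_cadjoint cinner_commute)

lemma contraction_cadjoint:
  fixes T :: "'a::{complex_inner, complete_space} \<Rightarrow> 'a"
  assumes T: "contraction T"
  shows "contraction (cadjoint T)"
proof (rule contractionI)
  note adj = cinner_cadjoint_left[OF contraction_bounded_clinear[OF T]]
  show "cadjoint T (x + y) = cadjoint T x + cadjoint T y" for x y
    by (rule cinner_ext_left) (simp add: cinner_add_left adj)
  show "cadjoint T (c *\<^sub>C x) = c *\<^sub>C cadjoint T x" for c x
    by (rule cinner_ext_left) (simp add: cinner_scaleC_left adj)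
  fix x
  have "(norm (cadjoint T x))\<^sup>2 = cmod (cinner (cadjoint T x) (cadjoint T x))"
    unfolding cinner_self norm_of_real by simp
  also have "\<dots> = cmod (cinner x (T (cadjoint T x)))"
    by (simp add: adj)
  also have "\<dots> \<le> norm x * norm (T (cadjoint T x))"
    by (rule norm_cinner_le)
  also have "\<dots> \<le> norm x * norm (cadjoint T x)"
    by (intro mult_left_mono contraction_norm_le[OF T]) simp
  finally show "norm (cadjoint T x) \<le> norm x"
    by (cases "cadjoint T x = 0") (simp_all add: power2_eq_square mult_le_cancel_right)
qed

section \<open>Square roots of \<open>I - C\<close>\<close>

text \<open>If \<open>B = I - Y\<close>, then \<open>B\<^sup>2 = I - C\<close> says that \<open>Y = (C + Y\<^sup>2) / 2\<close>. This equation is solved by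
  iteration from \<open>0\<close>. Every iterate is a polynomial in \<open>C\<close>, so whatever intertwines two such
  operators also intertwines their iterates and the limits.\<close>

fun root_iter :: "('a::complex_inner \<Rightarrow> 'a) \<Rightarrow> nat \<Rightarrow> 'a \<Rightarrow> 'a" where
  "root_iter C 0 x = 0"
| "root_iter C (Suc n) x = (1/2) *\<^sub>R (C x + root_iter C n (root_iter C n x))"

definition root_lim :: "('a::complex_inner \<Rightarrow> 'a) \<Rightarrow> 'a \<Rightarrow> 'a" where
  "root_lim C x = lim (\<lambda>n. root_iter C n x)"

text \<open>The same iteration for \<open>C = 1\<close> on scalars. It is increasing and bounded by \<open>1\<close>, and it majorises
  the iteration for any contraction, which makes the latter converge.\<close>

fun root_bound :: "nat \<Rightarrow> real" where
  "root_bound 0 = 0"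
| "root_bound (Suc n) = (1 + (root_bound n)\<^sup>2) / 2"

lemma root_bound_bounds: "0 \<le> root_bound n \<and> root_bound n \<le> 1"
proof (induction n)
  case (Suc n)
  then have "(root_bound n)\<^sup>2 \<le> 1"
    by (simp add: power_le_one)
  then show ?case
    by simp
qed simp

lemma root_bound_Suc_ge: "root_bound n \<le> root_bound (Suc n)"
  using zero_le_power2[of "root_bound n - 1"] by (simp add: power2_diff)

lemma root_bound_Cauchy: "Cauchy root_bound"
proof -
  have "convergent root_bound"
    using root_bound_bounds
    by (intro Bseq_mono_convergent BseqI'[of _ 1]) (auto intro: root_bound_Suc_ge lift_Suc_mono_le)
  then show ?thesis
    by (rule convergent_Cauchy)
qed

lemma root_iter_add:
  assumes "bounded_clinear C"
  shows "root_iter C n (x + y) = root_iter C n x + root_iter C n y"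
  by (induction n arbitrary: x y)
     (simp_all add: bounded_clinear_add[OF assms] scaleR_add_right add_ac)

lemma root_iter_scaleC:
  assumes "bounded_clinear C"
  shows "root_iter C n (c *\<^sub>C x) = c *\<^sub>C root_iter C n x"
  by (induction n arbitrary: x)
     (simp_all add: bounded_clinear_scaleC[OF assms] scaleC_add_right scaleC_scaleR_commute)

lemma root_iter_diff:
  assumes "bounded_clinear C"
  shows "root_iter C n (x - y) = root_iter C n x - root_iter C n y"
  using root_iter_add[OF assms, of n "x - y" y] by (simp add: algebra_simps)

lemma root_iter_norm_le:
  assumes C: "contraction C"
  shows "norm (root_iter C n x) \<le> root_bound n * norm x"
proof (induction n arbitrary: x)
  case (Suc n)
  have "norm (root_iter C n (root_iter C n x)) \<le> root_bound n * norm (root_iter C n x)"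
    by (rule Suc)
  also have "\<dots> \<le> root_bound n * (root_bound n * norm x)"
    by (intro mult_left_mono Suc) (simp add: root_bound_bounds)
  finally have "norm (C x + root_iter C n (root_iter C n x)) \<le> norm x + (root_bound n)\<^sup>2 * norm x"
    using contraction_norm_le[OF C, of x] by (intro norm_triangle_le) (simp add: power2_eq_square)
  then have "norm (root_iter C (Suc n) x) \<le> (norm x + (root_bound n)\<^sup>2 * norm x) / 2"
    unfolding root_iter.simps norm_scaleR by simp
  then show ?case
    by (simp add: field_simps)
qed simp

text \<open>With \<open>Y\<close>, \<open>Z\<close> for consecutive iterates, \<open>Y\<^sup>2 - Z\<^sup>2 = Y (Y - Z) + (Y - Z) Z\<close> needs no commutation,
  so each step is bounded by the corresponding step of the scalar iteration.\<close>

lemma root_iter_step_le: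
  assumes C: "contraction C"
  shows "norm (root_iter C (Suc n) x - root_iter C n x) \<le> (root_bound (Suc n) - root_bound n) * norm x"
proof (induction n arbitrary: x)
  case 0
  then show ?case
    using contraction_norm_le[OF C, of x] by simp
next
  case (Suc n)
  let ?Y = "root_iter C (Suc n)" and ?Z = "root_iter C n"
  let ?y = "root_bound (Suc n)" and ?z = "root_bound n"
  note lin = contraction_bounded_clinear[OF C]
  have "root_iter C (Suc (Suc n)) x - ?Y x = (1/2) *\<^sub>R (?Y (?Y x) - ?Z (?Z x))"
    by (subst (1 2) root_iter.simps(2)) (simp only: scaleR_diff_right[symmetric] add_diff_add diff_self add_0_left)
  also have "?Y (?Y x) - ?Z (?Z x) = ?Y (?Y x - ?Z x) + (?Y (?Z x) - ?Z (?Z x))"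
    by (simp only: root_iter_diff[OF lin]) simp
  finally have *: "root_iter C (Suc (Suc n)) x - ?Y x = (1/2) *\<^sub>R (?Y (?Y x - ?Z x) + (?Y (?Z x) - ?Z (?Z x)))" .
  have "norm (?Y (?Y x - ?Z x)) \<le> ?y * ((?y - ?z) * norm x)"
    by (rule order_trans[OF root_iter_norm_le[OF C]], intro mult_left_mono Suc)
       (use root_bound_bounds[of "Suc n"] in simp)
  moreover have "norm (?Y (?Z x) - ?Z (?Z x)) \<le> (?y - ?z) * (?z * norm x)"
    by (rule order_trans[OF Suc], intro mult_left_mono root_iter_norm_le[OF C])
       (use root_bound_Suc_ge[of n] in simp)
  ultimately have "norm (?Y (?Y x - ?Z x) + (?Y (?Z x) - ?Z (?Z x)))
      \<le> ?y * ((?y - ?z) * norm x) + (?y - ?z) * (?z * norm x)"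
    by (rule norm_triangle_mono)
  also have "\<dots> = (?y\<^sup>2 - ?z\<^sup>2) * norm x"
    by (simp only: power2_eq_square) (simp only: algebra_simps)
  also have "?y\<^sup>2 - ?z\<^sup>2 = 2 * (root_bound (Suc (Suc n)) - ?y)"
  proof -
    have "b\<^sup>2 - a\<^sup>2 = 2 * (c - b)" if "2 * b = 1 + a\<^sup>2" "2 * c = 1 + b\<^sup>2" for a b c :: real
      using that by simp
    then show ?thesis
      using root_bound.simps(2)[of n] root_bound.simps(2)[of "Suc n"] by (simp del: root_bound.simps)
  qed
  finally show ?case
    unfolding * norm_scaleR by (simp add: algebra_simps del: root_iter.simps root_bound.simps)
qed

lemma root_iter_diff_le:
  assumes C: "contraction C" and "m \<le> n"
  shows "norm (root_iter C n x - root_iter C m x) \<le> (root_bound n - root_bound m) * norm x"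
  using \<open>m \<le> n\<close>
proof (induction n rule: dec_induct)
  case (step n)
  have "norm ((root_iter C (Suc n) x - root_iter C n x) + (root_iter C n x - root_iter C m x))
    \<le> (root_bound (Suc n) - root_bound n) * norm x + (root_bound n - root_bound m) * norm x"
    by (intro norm_triangle_mono root_iter_step_le[OF C] step.IH)
  then show ?case
    by (simp only: left_diff_distrib) simp
qed simp

lemma root_iter_LIMSEQ:
  fixes C :: "'a::{complex_inner, complete_space} \<Rightarrow> 'a"
  assumes C: "contraction C"
  shows "(\<lambda>n. root_iter C n x) \<longlonglongrightarrow> root_lim C x"
proof -
  have "Cauchy (\<lambda>n. root_iter C n x)"
  proof (rule metric_CauchyI)
    fix e :: real assume e: "0 < e"
    define d where "d = e / (norm x + 1)"
    have "norm x + 1 > 0"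
      by (simp add: add_nonneg_pos)
    then have d: "0 < d" "d * norm x < e"
      using e by (auto simp: d_def field_simps)
    obtain M where M: "\<And>k l. k \<ge> M \<Longrightarrow> l \<ge> M \<Longrightarrow> dist (root_bound k) (root_bound l) < d"
      using metric_CauchyD[OF root_bound_Cauchy d(1)] by blast
    have le: "norm (root_iter C l x - root_iter C k x) < e" if "k \<ge> M" "k \<le> l" for k l
    proof -
      have "root_bound l - root_bound k \<le> d"
        using M[of l k] that by (simp add: dist_real_def)
      then have "(root_bound l - root_bound k) * norm x \<le> d * norm x"
        by (intro mult_right_mono) auto
      then show ?thesis
        using root_iter_diff_le[OF C that(2), of x] d by linarith
    qed
    have "dist (root_iter C k x) (root_iter C l x) < e" if "k \<ge> M" "l \<ge> M" for k l
      using le[of k l] le[of l k] that by (cases "k \<le> l") (auto simp: dist_norm norm_minus_commute)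
    then show "\<exists>M. \<forall>k\<ge>M. \<forall>l\<ge>M. dist (root_iter C k x) (root_iter C l x) < e"
      by blast
  qed
  then show ?thesis
    unfolding root_lim_def by (simp add: Cauchy_convergent_iff convergent_LIMSEQ_iff)
qed

lemma root_iter_contractive: "contraction C \<Longrightarrow> norm (root_iter C n x) \<le> norm x"
  using root_iter_norm_le[of C n x] root_bound_bounds[of n] mult_left_le_one_le[of "norm x" "root_bound n"]
  by auto

lemma contraction_root_lim:
  fixes C :: "'a::{complex_inner, complete_space} \<Rightarrow> 'a"
  assumes C: "contraction C"
  shows "contraction (root_lim C)"
proof (rule contractionI)
  note lim = root_iter_LIMSEQ[OF C] and lin = contraction_bounded_clinear[OF C]
  show "root_lim C (x + y) = root_lim C x + root_lim C y" for x y
    by (rule LIMSEQ_unique[OF lim]) (simp only: root_iter_add[OF lin], intro tendsto_add lim)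
  show "root_lim C (c *\<^sub>C x) = c *\<^sub>C root_lim C x" for c x
    by (rule LIMSEQ_unique[OF lim])
       (simp only: root_iter_scaleC[OF lin], intro bounded_linear.tendsto[OF bounded_linear_scaleC] lim)
  show "norm (root_lim C x) \<le> norm x" for x
    using LIMSEQ_le_const2[OF tendsto_norm[OF lim]] root_iter_contractive[OF C] by blast
qed

text \<open>The square \<open>Y\<^sub>n (Y\<^sub>n x)\<close> converges to \<open>Y (Y x)\<close> because the \<open>Y\<^sub>n\<close> are contractive.\<close>

lemma root_lim_fixpoint:
  fixes C :: "'a::{complex_inner, complete_space} \<Rightarrow> 'a"
  assumes C: "contraction C"
  shows "root_lim C x = (1/2) *\<^sub>R (C x + root_lim C (root_lim C x))"
proof (rule LIMSEQ_unique)
  note lim = root_iter_LIMSEQ[OF C] and lin = contraction_bounded_clinear[OF C]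
  show "(\<lambda>n. root_iter C (Suc n) x) \<longlonglongrightarrow> root_lim C x"
    using lim by (rule LIMSEQ_Suc)
  have "(\<lambda>n. root_iter C n (root_iter C n x - root_lim C x)) \<longlonglongrightarrow> 0"
  proof (rule tendsto_norm_zero_cancel, rule tendsto_sandwich[OF _ _ tendsto_const])
    show "\<forall>\<^sub>F n in sequentially. norm (root_iter C n (root_iter C n x - root_lim C x))
        \<le> norm (root_iter C n x - root_lim C x)"
      by (intro always_eventually allI root_iter_contractive[OF C])
    show "(\<lambda>n. norm (root_iter C n x - root_lim C x)) \<longlonglongrightarrow> 0"
      using lim by (simp add: LIM_zero tendsto_norm_zero)
  qed simp
  from tendsto_add[OF this lim[of "root_lim C x"]]
  have "(\<lambda>n. root_iter C n (root_iter C n x)) \<longlonglongrightarrow> root_lim C (root_lim C x)"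
    by (simp add: root_iter_diff[OF lin])
  then show "(\<lambda>n. root_iter C (Suc n) x) \<longlonglongrightarrow> (1/2) *\<^sub>R (C x + root_lim C (root_lim C x))"
    unfolding root_iter.simps by (intro tendsto_intros)
qed

text \<open>With \<open>X = T\<close>, \<open>A = T\<^sup>*T\<close>, \<open>B = TT\<^sup>*\<close> this is the source of \<open>T D\<^sub>T = D\<^sub>T\<^sub>* T\<close>; with \<open>A = B\<close> it says
  that the limit commutes with everything that commutes with \<open>A\<close>.\<close>

lemma root_lim_intertwines:
  fixes A B :: "'a::{complex_inner, complete_space} \<Rightarrow> 'a"
  assumes A: "contraction A" and B: "contraction B" and X: "bounded_clinear X"
    and XA: "\<And>x. X (A x) = B (X x)"
  shows "X (root_lim A x) = root_lim B (X x)"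
proof -
  have "X (root_iter A n x) = root_iter B n (X x)" for n x
    by (induction n arbitrary: x)
       (simp_all add: bounded_clinear_zero[OF X] bounded_clinear_add[OF X] bounded_clinear_scaleR[OF X] XA)
  moreover have "(\<lambda>n. X (root_iter A n x)) \<longlonglongrightarrow> X (root_lim A x)"
    by (intro bounded_linear.tendsto[OF bounded_clinear_bounded_linear[OF X]] root_iter_LIMSEQ A)
  ultimately have "(\<lambda>n. root_iter B n (X x)) \<longlonglongrightarrow> X (root_lim A x)"
    by simp
  then show ?thesis
    using root_iter_LIMSEQ[OF B] by (rule LIMSEQ_unique)
qed

lemma root_lim_selfadjoint:
  fixes C :: "'a::{complex_inner, complete_space} \<Rightarrow> 'a"
  assumes C: "contraction C" and sa: "\<And>x y. cinner (C x) y = cinner x (C y)"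
  shows "cinner (root_lim C x) y = cinner x (root_lim C y)"
proof -
  have iter: "cinner (root_iter C n x) y = cinner x (root_iter C n y)" for n x y
    by (induction n arbitrary: x y) (simp_all add: cinner_linear sa)
  have bl: "bounded_linear (\<lambda>x. cinner x z)" "bounded_linear (\<lambda>x. cinner z x)" for z :: 'a
    by (rule bounded_linear_intro[where K = "norm z"],
        auto simp: cinner_linear norm_cinner_le scaleR_conv_of_real)
       (rule bounded_linear_intro[where K = "norm z"],
        auto simp: cinner_linear norm_cinner_le scaleR_conv_of_real mult.commute[of _ "norm z"])
  have "(\<lambda>n. cinner (root_iter C n x) y) \<longlonglongrightarrow> cinner (root_lim C x) y"
    by (intro bounded_linear.tendsto[OF bl(1)] root_iter_LIMSEQ C)
  moreover have "(\<lambda>n. cinner x (root_iter C n y)) \<longlonglongrightarrow> cinner x (root_lim C y)"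
    by (intro bounded_linear.tendsto[OF bl(2)] root_iter_LIMSEQ C)
  ultimately show ?thesis
    unfolding iter by (rule LIMSEQ_unique)
qed

section \<open>Uniqueness of the positive square root\<close>

text \<open>Polarization: the quadratic form is real at \<open>x + y\<close> and at \<open>\<i> x + y\<close>.\<close>

lemma positive_op_selfadjoint:
  assumes "positive_op A"
  shows "cinner (A x) y = cinner x (A y)"
proof -
  have lin: "bounded_clinear A" and pos: "\<And>x. Im (cinner (A x) x) = 0"
    using assms by (auto simp: positive_op_def complex_nonneg_Reals_iff)
  \<comment> \<open>the mixed terms at \<open>x + y\<close> give the imaginary parts, those at \<open>\<i> x + y\<close> the real parts\<close>
  have "Im (cinner (A x) y) + Im (cinner (A y) x) = 0"
    using pos[of "x + y"] pos[of x] pos[of y]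
    by (simp add: bounded_clinear_add[OF lin] cinner_linear)
  moreover have "Re (cinner (A x) y) - Re (cinner (A y) x) = 0"
    using pos[of "\<i> *\<^sub>C x + y"] pos[of x] pos[of y]
    by (simp add: bounded_clinear_add[OF lin] bounded_clinear_scaleC[OF lin] cinner_linear
        cinner_scaleC_left cinner_scaleC_right)
  ultimately have "cinner (A x) y = cnj (cinner (A y) x)"
    by (simp add: complex_eq_iff)
  then show ?thesis
    by (metis cinner_commute)
qed

text \<open>The nonnegative form \<open>\<langle>A v, v\<rangle>\<close> has a minimum at \<open>y\<close>, so its variation in the direction \<open>A y\<close>
  vanishes there.\<close>

lemma positive_op_null:
  assumes A: "positive_op A" and 0: "cinner (A y) y = 0"
  shows "A y = 0"
proof -
  have lin: "bounded_clinear A" and pos: "\<And>x. 0 \<le> Re (cinner (A x) x)"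
    using A by (auto simp: positive_op_def complex_nonneg_Reals_iff)
  have "0 \<le> 2 * t * (norm (A y))\<^sup>2 + t\<^sup>2 * Re (cinner (A (A y)) (A y))" for t
  proof -
    have "cinner (A (y + t *\<^sub>R A y)) (y + t *\<^sub>R A y)
      = 2 * t * cinner (A y) (A y) + t\<^sup>2 * cinner (A (A y)) (A y)"
      using 0 by (simp add: bounded_clinear_add[OF lin] bounded_clinear_scaleR[OF lin] cinner_linear
          positive_op_selfadjoint[OF A, of "A y" y] power2_eq_square algebra_simps)
    then show ?thesis
      using pos[of "y + t *\<^sub>R A y"] by (simp add: cinner_self)
  qed
  then have "(norm (A y))\<^sup>2 = 0"
    by (rule quadratic_nonneg_imp_linear_coeff_zero)
  then show ?thesis
    by simp
qed

text \<open>For \<open>y = (B - R) x\<close> commutativity gives \<open>(B + R) y = (B\<^sup>2 - R\<^sup>2) x = 0\<close>. Both summands of \<open>\<langle>(B + R) y, y\<rangle>\<close>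
  are nonnegative, so \<open>B y = R y = 0\<close>, and then \<open>\<parallel>y\<parallel>\<^sup>2 = \<langle>x, (B - R) y\<rangle> = 0\<close>.\<close>

lemma commuting_positive_roots_eq:
  assumes B: "positive_op B" and R: "positive_op R"
    and comm: "\<And>x. B (R x) = R (B x)" and sq: "\<And>x. B (B x) = R (R x)"
  shows "B x = R x"
proof -
  have lin: "bounded_clinear B" "bounded_clinear R"
    using B R by (auto simp: positive_op_def)
  define y where "y = B x - R x"
  have "B y + R y = 0"
    by (simp add: y_def bounded_clinear_diff[OF lin(1)] bounded_clinear_diff[OF lin(2)] comm sq)
  then have "cinner (B y) y + cinner (R y) y = 0"
    by (metis cinner_add_left cinner_zero_left)
  moreover have "cinner (B y) y \<in> \<real>\<^sub>\<ge>\<^sub>0" "cinner (R y) y \<in> \<real>\<^sub>\<ge>\<^sub>0"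
    using B R by (auto simp: positive_op_def)
  ultimately have "cinner (B y) y = 0" "cinner (R y) y = 0"
    by (auto simp: complex_nonneg_Reals_iff complex_eq_iff)
  then have "B y = 0" "R y = 0"
    using positive_op_null B R by auto
  have "cinner y y = cinner x (B y) - cinner x (R y)"
    unfolding positive_op_selfadjoint[OF B, symmetric] positive_op_selfadjoint[OF R, symmetric]
    by (subst (1) y_def) (rule cinner_diff_left)
  then have "cinner y y = 0"
    using \<open>B y = 0\<close> \<open>R y = 0\<close> by simp
  then show ?thesis
    by (simp add: cinner_self y_def)
qed

text \<open>The square root is defined by a description, so its uniqueness is part of computing it. A
  positive root \<open>B\<close> of \<open>I - C\<close> commutes with \<open>B\<^sup>2\<close>, hence with \<open>C\<close> and with the root built from \<open>C\<close>.\<close>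

lemma sqrt_op_eq:
  fixes C :: "'a::{complex_inner, complete_space} \<Rightarrow> 'a"
  assumes C: "contraction C" and sa: "\<And>x y. cinner (C x) y = cinner x (C y)"
  shows "sqrt_op (\<lambda>x. x - C x) = (\<lambda>x. x - root_lim C x)"
    and "positive_op (\<lambda>x. x - root_lim C x)"
    and "(x - root_lim C x) - root_lim C (x - root_lim C x) = x - C x"
proof -
  let ?R = "\<lambda>x. x - root_lim C x"
  note Y = contraction_root_lim[OF C]
  note lin = contraction_bounded_clinear[OF Y]
  show sq: "?R (?R x) = x - C x" for x
  proof -
    have "2 *\<^sub>R root_lim C x = C x + root_lim C (root_lim C x)"
      by (subst root_lim_fixpoint[OF C]) simp
    then show ?thesis
      by (simp add: bounded_clinear_diff[OF lin] scaleR_2 algebra_simps)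
  qed
  show pos: "positive_op ?R"
    unfolding positive_op_def
  proof (intro conjI allI)
    show "bounded_clinear ?R"
    proof (rule bounded_clinearI[where K = 2])
      show "norm (?R x) \<le> norm x * 2" for x
        using norm_triangle_ineq4[of x "root_lim C x"] contraction_norm_le[OF Y, of x] by simp
    qed (simp_all add: bounded_clinear_add[OF lin] bounded_clinear_scaleC[OF lin] scaleC_diff_right)
    fix x
    have "cinner (root_lim C x) x = cnj (cinner (root_lim C x) x)"
      by (metis cinner_commute root_lim_selfadjoint[OF C sa])
    then have "Im (cinner (root_lim C x) x) = 0"
      by (metis cnj.simps(2) equal_neg_zero)
    moreover have "Re (cinner (root_lim C x) x) \<le> (norm x)\<^sup>2"
    proof -
      have "Re (cinner (root_lim C x) x) \<le> norm (root_lim C x) * norm x"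
        using norm_cinner_le complex_Re_le_cmod order_trans by blast
      also have "\<dots> \<le> norm x * norm x"
        by (intro mult_right_mono contraction_norm_le[OF Y]) simp
      finally show ?thesis
        by (simp add: power2_eq_square)
    qed
    ultimately show "cinner (?R x) x \<in> \<real>\<^sub>\<ge>\<^sub>0"
      by (simp add: complex_nonneg_Reals_iff cinner_diff_left cinner_self)
  qed
  show "sqrt_op (\<lambda>x. x - C x) = ?R"
    unfolding sqrt_op_def
  proof (rule the_equality)
    show "positive_op ?R \<and> ?R \<circ> ?R = (\<lambda>x. x - C x)"
      using pos sq by (auto simp: fun_eq_iff)
    fix B assume "positive_op B \<and> B \<circ> B = (\<lambda>x. x - C x)"
    then have B: "positive_op B" and BB: "\<And>x. B (B x) = x - C x"
      by (auto simp: fun_eq_iff)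
    have linB: "bounded_clinear B"
      using B by (simp add: positive_op_def)
    have "B (C x) = C (B x)" for x
      using BB[of "B x"] BB[of x] bounded_clinear_diff[OF linB, of x "C x"] by simp
    then have "B (root_lim C x) = root_lim C (B x)" for x
      by (rule root_lim_intertwines[OF C C linB])
    then show "B = ?R"
      by (intro ext commuting_positive_roots_eq[OF B pos])
         (simp_all add: bounded_clinear_diff[OF linB] BB sq)
  qed
qed

section \<open>Defect operators\<close>

lemma cadjoint_cadjoint:
  fixes T :: "'a::{complex_inner, complete_space} \<Rightarrow> 'a"
  assumes T: "contraction T"
  shows "cadjoint (cadjoint T) = T"
proof
  fix x
  have lin: "bounded_clinear T" "bounded_clinear (cadjoint T)"
    using contraction_cadjoint[OF T] T by (auto simp: contraction_def)
  show "cadjoint (cadjoint T) x = T x"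
    by (rule cinner_ext_right) (simp add: cinner_cadjoint[OF lin(2)] cinner_cadjoint_left[OF lin(1)])
qed

lemma gram_contraction:
  fixes R :: "'a::{complex_inner, complete_space} \<Rightarrow> 'a"
  assumes R: "contraction R"
  shows "contraction (\<lambda>x. cadjoint R (R x))"
    and "cinner (cadjoint R (R x)) y = cinner x (cadjoint R (R y))"
  using contraction_compose[OF contraction_cadjoint[OF R] R] contraction_bounded_clinear[OF R]
  by (simp_all add: comp_def cinner_cadjoint cinner_cadjoint_left)

lemma defect_eq:
  fixes R :: "'a::{complex_inner, complete_space} \<Rightarrow> 'a"
  assumes "contraction R"
  shows "defect R x = x - root_lim (\<lambda>x. cadjoint R (R x)) x"
  unfolding defect_def sqrt_op_eq(1)[OF gram_contraction[OF assms]] ..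

lemma bounded_clinear_defect:
  fixes R :: "'a::{complex_inner, complete_space} \<Rightarrow> 'a"
  assumes "contraction R"
  shows "bounded_clinear (defect R)"
  using sqrt_op_eq(1,2)[OF gram_contraction[OF assms]] by (simp add: defect_def positive_op_def)

lemma defect_selfadjoint:
  fixes R :: "'a::{complex_inner, complete_space} \<Rightarrow> 'a"
  assumes "contraction R"
  shows "cinner (defect R x) y = cinner x (defect R y)"
  using positive_op_selfadjoint sqrt_op_eq(1,2)[OF gram_contraction[OF assms]] by (metis defect_def)

lemma defect_defect:
  fixes R :: "'a::{complex_inner, complete_space} \<Rightarrow> 'a"
  assumes "contraction R"
  shows "defect R (defect R x) = x - cadjoint R (R x)"
  using sqrt_op_eq(3)[OF gram_contraction[OF assms]] by (simp add: defect_eq[OF assms])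

text \<open>The defect operator measures what \<open>R\<close> loses: \<open>x \<mapsto> (R x, D\<^sub>R x)\<close> is an isometry.\<close>

lemma cinner_defect_defect:
  fixes R :: "'a::{complex_inner, complete_space} \<Rightarrow> 'a"
  assumes "contraction R"
  shows "cinner (defect R x) (defect R y) = cinner x y - cinner (R x) (R y)"
  by (simp add: defect_selfadjoint[OF assms] defect_defect[OF assms] cinner_diff_right
      cinner_cadjoint[OF contraction_bounded_clinear[OF assms]])

lemma defect_intertwines:
  fixes R Q X :: "'a::{complex_inner, complete_space} \<Rightarrow> 'a"
  assumes R: "contraction R" and Q: "contraction Q" and X: "bounded_clinear X"
    and "\<And>x. X (cadjoint R (R x)) = cadjoint Q (Q (X x))"
  shows "X (defect R x) = defect Q (X x)"
  using root_lim_intertwines[OF gram_contraction(1)[OF R] gram_contraction(1)[OF Q] X] assms(4)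
  by (simp add: defect_eq[OF R] defect_eq[OF Q] bounded_clinear_diff[OF X])

text \<open>By this identity the facts on \<open>D\<^sub>R\<^sub>*\<close> are those on the defect operator of the contraction \<open>R\<^sup>*\<close>.\<close>

lemma defect_star_eq:
  fixes R :: "'a::{complex_inner, complete_space} \<Rightarrow> 'a"
  assumes "contraction R"
  shows "defect_star R = defect (cadjoint R)"
  by (simp add: defect_def defect_star_def cadjoint_cadjoint[OF assms])

lemma contraction_defect_commute:
  fixes R :: "'a::{complex_inner, complete_space} \<Rightarrow> 'a"
  assumes R: "contraction R"
  shows "R (defect R x) = defect_star R (R x)"
  unfolding defect_star_eq[OF R]
  by (rule defect_intertwines[OF R contraction_cadjoint[OF R] contraction_bounded_clinear[OF R]])
     (simp add: cadjoint_cadjoint[OF R])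

section \<open>Unitaries\<close>

lemma unitary_onI:
  assumes "\<And>x y. U (x + y) = U x + U y" "\<And>c x. U (c *\<^sub>C x) = c *\<^sub>C U x"
    and inn: "\<And>x y. cinner (U x) (U y) = cinner x y" and "surj U"
  shows "unitary_on UNIV U"
proof -
  have "norm (U x) = norm x" for x
    by (rule norm_eq_if_cinner_eq) (rule inn)
  then have "bounded_clinear U"
    using assms by (intro bounded_clinearI[where K = 1]) auto
  then show ?thesis
    using assms by (simp add: unitary_on_def bounded_clinear_on_UNIV)
qed

lemma unitary_bounded_clinear: "unitary_on UNIV U \<Longrightarrow> bounded_clinear U"
  by (simp add: unitary_on_def bounded_clinear_on_UNIV)

lemma unitary_cinner: "unitary_on UNIV U \<Longrightarrow> cinner (U x) (U y) = cinner x y"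
  by (simp add: unitary_on_def)

lemma unitary_surj: "unitary_on UNIV U \<Longrightarrow> surj U"
  by (simp add: unitary_on_def)

lemma unitary_norm: "unitary_on UNIV U \<Longrightarrow> norm (U x) = norm x"
  by (rule norm_eq_if_cinner_eq) (rule unitary_cinner)

lemma unitary_contraction: "unitary_on UNIV U \<Longrightarrow> contraction U"
  by (rule contractionI)
     (auto dest: unitary_bounded_clinear simp: bounded_clinear_add bounded_clinear_scaleC unitary_norm)

lemma unitary_compose:
  assumes U: "unitary_on UNIV U" and V: "unitary_on UNIV V"
  shows "unitary_on UNIV (U \<circ> V)"
proof (rule unitary_onI)
  show "surj (U \<circ> V)"
    using U V by (intro comp_surj unitary_surj)
qed (use U V in \<open>auto dest!: unitary_bounded_clinear simp: bounded_clinear_add bounded_clinear_scaleC unitary_cinner\<close>)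

lemma unitary_id: "unitary_on UNIV id"
  by (rule unitary_onI) auto

lemma cadjoint_unitary_compose:
  fixes S T :: "'a::{complex_inner, complete_space} \<Rightarrow> 'a"
  assumes S: "unitary_on UNIV S" and T: "contraction T"
  shows "cadjoint (S \<circ> T) ((S \<circ> T) x) = cadjoint T (T x)"
proof (rule cinner_ext_right)
  fix z
  note ST = contraction_compose[OF unitary_contraction[OF S] T]
  show "cinner z (cadjoint (S \<circ> T) ((S \<circ> T) x)) = cinner z (cadjoint T (T x))"
    unfolding cinner_cadjoint[OF contraction_bounded_clinear[OF ST]]
      cinner_cadjoint[OF contraction_bounded_clinear[OF T]]
    by (simp add: unitary_cinner[OF S])
qed

text \<open>\<open>(ST)\<^sup>*ST = T\<^sup>*T\<close>, so \<open>T\<close> and \<open>ST\<close> have the same defect operator. Their dilations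
  therefore send a vector at index \<open>0\<close> to vectors with the same component at index \<open>-1\<close>.\<close>

lemma defect_unitary_compose:
  fixes S T :: "'a::{complex_inner, complete_space} \<Rightarrow> 'a"
  assumes "unitary_on UNIV S" and "contraction T"
  shows "defect (S \<circ> T) = defect T"
  unfolding defect_def cadjoint_unitary_compose[OF assms] ..

text \<open>As \<open>S\<close> is onto, it suffices to test against the vectors \<open>S w\<close>, and
  \<open>\<langle>S w, S T\<^sup>* x\<rangle> = \<langle>T w, x\<rangle> = \<langle>S T w, S x\<rangle> = \<langle>T S w, S x\<rangle>\<close>.\<close>

lemma unitary_commutes_cadjoint:
  fixes S T :: "'a::{complex_inner, complete_space} \<Rightarrow> 'a"
  assumes S: "unitary_on UNIV S" and T: "contraction T" and comm: "\<And>x. S (T x) = T (S x)"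
  shows "S (cadjoint T x) = cadjoint T (S x)"
proof (rule cinner_ext_right)
  fix z
  obtain w where z: "z = S w"
    using unitary_surj[OF S] by blast
  show "cinner z (S (cadjoint T x)) = cinner z (cadjoint T (S x))"
    by (simp add: z cinner_cadjoint[OF contraction_bounded_clinear[OF T]] unitary_cinner[OF S] comm[symmetric])
qed

lemma unitary_commutes_defect:
  fixes S T :: "'a::{complex_inner, complete_space} \<Rightarrow> 'a"
  assumes S: "unitary_on UNIV S" and T: "contraction T" and comm: "\<And>x. S (T x) = T (S x)"
  shows "S (defect T x) = defect T (S x)" "S (defect_star T x) = defect_star T (S x)"
  unfolding defect_star_eq[OF T]
  by (rule defect_intertwines[OF _ _ unitary_bounded_clinear[OF S]],
      simp_all add: T contraction_cadjoint cadjoint_cadjoint unitary_commutes_cadjoint[OF assms] comm)+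

section \<open>Birkhoff-James orthogonality of unitaries\<close>

text \<open>If \<open>\<langle>U h\<^sub>n, V h\<^sub>n\<rangle> \<longlonglongrightarrow> 0\<close> along unit vectors, then \<open>\<parallel>(U + m V) h\<^sub>n\<parallel>\<^sup>2 \<longlonglongrightarrow> 1 + \<bar>m\<bar>\<^sup>2\<close> and \<open>U \<bottom>\<^sub>B V\<close>. Such vectors
  are found between the \<open>x\<^sub>n\<close>, where the form tends to \<open>l \<le> 0\<close>, and \<open>z\<close>, where it equals \<open>1\<close>: the
  orthogonality relations make the form additive along \<open>h\<^sub>n = a x\<^sub>n + b z\<close>.\<close>

lemma bj_orthogonal_unitaries:
  fixes U V :: "'b::complex_inner \<Rightarrow> 'b" and x :: "nat \<Rightarrow> 'b"
  assumes U: "unitary_on UNIV U" and V: "unitary_on UNIV V"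
    and lim: "(\<lambda>n. cinner (U (x n)) (V (x n))) \<longlonglongrightarrow> l" and l: "l \<in> \<real>\<^sub>\<le>\<^sub>0"
    and x: "\<And>n. norm (x n) = 1" and z: "norm z = 1" and UVz: "U z = V z"
    and orth: "\<And>n. cinner (x n) z = 0" "\<And>n. cinner (U (x n)) (V z) = 0"
      "\<And>n. cinner (U z) (V (x n)) = 0"
  shows "bj_orthogonal_on UNIV U V"
proof -
  note linU = unitary_bounded_clinear[OF U] and linV = unitary_bounded_clinear[OF V]
  obtain r :: real where r: "r \<ge> 0" "l = - complex_of_real r"
  proof -
    obtain s where "l = of_real s" "s \<le> 0"
      using l by (auto simp: nonpos_Reals_def)
    then show ?thesis
      using that[of "- s"] by simp
  qed
  \<comment> \<open>chosen such that \<open>a\<^sup>2 + b\<^sup>2 = 1\<close> and \<open>a\<^sup>2 l + b\<^sup>2 = 0\<close>\<close>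
  define a b where "a = sqrt (1 / (1 + r))" and "b = sqrt (r / (1 + r))"
  have ab: "a\<^sup>2 = 1 / (1 + r)" "b\<^sup>2 = r / (1 + r)"
    using r by (simp_all add: a_def b_def)
  have ab1: "a\<^sup>2 + b\<^sup>2 = 1" "a\<^sup>2 * r = b\<^sup>2"
    unfolding ab using r by (simp_all add: field_simps)
  define h where "h n = a *\<^sub>R x n + b *\<^sub>R z" for n
  have hh: "norm (h n) = 1" for n
  proof -
    have "cinner (h n) (h n) = complex_of_real (a\<^sup>2 + b\<^sup>2)"
      using orth(1)[of n] cinner_eq_zero_commute[of "x n" z]
      unfolding h_def cinner_linear by (simp add: cinner_self x z power2_eq_square)
    then have "(norm (h n))\<^sup>2 = 1\<^sup>2"
      unfolding cinner_self ab1 of_real_eq_iff by simp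
    then show ?thesis
      by (simp only: power2_eq_iff_nonneg norm_ge_zero zero_le_one)
  qed
  define d where "d n = cinner (U (h n)) (V (h n))" for n
  have d: "d n = a\<^sup>2 * cinner (U (x n)) (V (x n)) + b\<^sup>2" for n
  proof -
    have "cinner (U z) (V z) = 1"
      unfolding UVz unitary_cinner[OF V] by (simp add: cinner_self z)
    then show ?thesis
      using orth(2,3)[of n]
      by (simp add: d_def h_def bounded_clinear_add[OF linU] bounded_clinear_scaleR[OF linU]
          bounded_clinear_add[OF linV] bounded_clinear_scaleR[OF linV] cinner_linear power2_eq_square)
  qed
  have "d \<longlonglongrightarrow> a\<^sup>2 * l + b\<^sup>2"
    unfolding d by (intro tendsto_intros lim)
  also have "complex_of_real (a\<^sup>2) * l + b\<^sup>2 = complex_of_real (b\<^sup>2 - a\<^sup>2 * r)"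
    by (simp add: r)
  finally have d0: "d \<longlonglongrightarrow> 0"
    by (simp add: ab1)
  have "onorm U \<le> 1"
    by (rule onorm_bound) (simp_all add: unitary_norm[OF U])
  also have "1 \<le> onorm (\<lambda>x. U x + m *\<^sub>C V x)" for m
  proof -
    define N where "N = onorm (\<lambda>x. U x + m *\<^sub>C V x)"
    have lin: "bounded_linear (\<lambda>x. U x + m *\<^sub>C V x)"
      by (intro bounded_linear_add bounded_clinear_bounded_linear[OF linU]
          bounded_linear_compose[OF bounded_linear_scaleC bounded_clinear_bounded_linear[OF linV]])
    have N: "1 + (cmod m)\<^sup>2 + 2 * Re (cnj m * d n) \<le> N\<^sup>2" for n
    proof -
      let ?u = "U (h n)" and ?v = "V (h n)"
      have "complex_of_real ((norm (?u + m *\<^sub>C ?v))\<^sup>2) = cinner (?u + m *\<^sub>C ?v) (?u + m *\<^sub>C ?v)"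
        by (simp add: cinner_self)
      also have "\<dots> = cinner ?u ?u + m * cnj m * cinner ?v ?v + (cnj m * d n + cnj (cnj m * d n))"
        unfolding cinner_linear cinner_scaleC_left cinner_scaleC_right
        by (simp add: d_def cinner_commute[of ?v ?u] algebra_simps)
      also have "cinner ?u ?u = 1"
        unfolding unitary_cinner[OF U] by (simp add: cinner_self hh)
      also have "cinner ?v ?v = 1"
        unfolding unitary_cinner[OF V] by (simp add: cinner_self hh)
      finally have "(norm (?u + m *\<^sub>C ?v))\<^sup>2 = Re (1 + m * cnj m * 1 + (cnj m * d n + cnj (cnj m * d n)))"
        by (metis Re_complex_of_real)
      also have "\<dots> = 1 + (cmod m)\<^sup>2 + 2 * Re (cnj m * d n)"
        unfolding cmod_power2 by (simp add: power2_eq_square)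
      finally have "1 + (cmod m)\<^sup>2 + 2 * Re (cnj m * d n) = (norm (?u + m *\<^sub>C ?v))\<^sup>2" ..
      also have "\<dots> \<le> (N * norm (h n))\<^sup>2"
        unfolding N_def by (intro power_mono onorm[OF lin]) simp
      finally show ?thesis
        by (simp add: hh)
    qed
    have "(\<lambda>n. 1 + (cmod m)\<^sup>2 + 2 * Re (cnj m * d n)) \<longlonglongrightarrow> 1 + (cmod m)\<^sup>2 + 2 * Re (cnj m * 0)"
      by (intro tendsto_intros d0)
    then have "1 + (cmod m)\<^sup>2 + 2 * Re (cnj m * 0) \<le> N\<^sup>2"
      by (rule LIMSEQ_le_const2) (use N in blast)
    then have "1 + (cmod m)\<^sup>2 \<le> N\<^sup>2"
      by simp
    moreover have "1\<^sup>2 \<le> 1 + (cmod m)\<^sup>2"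
      by simp
    ultimately have "1\<^sup>2 \<le> N\<^sup>2"
      by (rule order_trans[rotated])
    then show ?thesis
      using onorm_pos_le[OF lin] unfolding N_def by (rule power2_le_imp_le)
  qed
  finally show ?thesis
    by (simp add: bj_orthogonal_on_def onorm_on_UNIV)
qed

section \<open>Coordinates, direct sums and ampliations\<close>

lemma hsum_eqI: "(\<And>n. component h n = component k n) \<Longrightarrow> h = k"
  by (simp add: component_inject[symmetric] fun_eq_iff)

lift_definition single :: "int \<Rightarrow> 'a \<Rightarrow> 'a::complex_inner hsum" is
  "\<lambda>m x n. if n = m then x else 0"
proof -
  fix m :: int and x :: 'a
  have "(\<lambda>n. (norm (if n = m then x else 0))\<^sup>2) summable_on {m} \<longleftrightarrow>
    (\<lambda>n. (norm (if n = m then x else 0))\<^sup>2) summable_on UNIV"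
    by (rule summable_on_cong_neutral) auto
  then show "(\<lambda>n. (norm (if n = m then x else 0))\<^sup>2) summable_on UNIV"
    by simp
qed

lemma cinner_single_right [simp]: "cinner h (single m x) = cinner (component h m) x"
proof -
  have "cinner h (single m x) = (\<Sum>\<^sub>\<infinity>n\<in>{m}. cinner (component h n) (component (single m x) n))"
    unfolding cinner_hsum_def by (rule infsum_cong_neutral) (auto simp: single.rep_eq)
  then show ?thesis
    by (simp add: single.rep_eq)
qed

lemma cinner_single_left [simp]: "cinner (single m x) h = cinner x (component h m)"
  by (metis cinner_commute cinner_single_right)

lemma has_sum_interleave:
  fixes f g :: "int \<Rightarrow> 'b::{topological_comm_monoid_add, t2_space}"
  assumes f: "(f has_sum a) UNIV" and g: "(g has_sum b) UNIV"
  shows "((\<lambda>n. if even n then f (n div 2) else g (n div 2)) has_sum (a + b)) UNIV"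
proof -
  let ?F = "\<lambda>n. if even n then f (n div 2) else g (n div 2)"
  have "bij_betw (\<lambda>n::int. 2 * n) UNIV {n. even n}"
    by (rule bij_betwI[where g = "\<lambda>n. n div 2"]) auto
  from has_sum_reindex_bij_betw[OF this, of ?F a] f
  have "(?F has_sum a) {n. even n}"
    by simp
  moreover have "bij_betw (\<lambda>n::int. 2 * n + 1) UNIV {n. odd n}"
    by (rule bij_betwI[where g = "\<lambda>n. n div 2"]) auto
  from has_sum_reindex_bij_betw[OF this, of ?F b] g
  have "(?F has_sum b) {n. odd n}"
    by simp
  ultimately have "(?F has_sum (a + b)) ({n. even n} \<union> {n. odd n})"
    by (rule has_sum_Un_disjoint) auto
  also have "{n::int. even n} \<union> {n. odd n} = UNIV"
    by auto
  finally show ?thesis .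
qed

text \<open>A unitary equivalence of \<open>H \<oplus> H\<close> with \<open>H\<close> itself, for \<open>H\<close> the Hilbert sum over the integers: the two
  summands are put on the even and on the odd indices. It makes room for a further direct summand
  without leaving the type.\<close>

lift_definition interleave :: "'a::complex_inner hsum \<Rightarrow> 'a hsum \<Rightarrow> 'a hsum" is
  "\<lambda>h k n. if even n then h (n div 2) else k (n div 2)"
proof -
  fix h k :: "int \<Rightarrow> 'a"
  assume "(\<lambda>n. (norm (h n))\<^sup>2) summable_on UNIV" "(\<lambda>n. (norm (k n))\<^sup>2) summable_on UNIV"
  then show "(\<lambda>n. (norm (if even n then h (n div 2) else k (n div 2)))\<^sup>2) summable_on UNIV"
    using has_sum_interleave unfolding summable_on_def if_distrib[of norm] if_distrib[of "\<lambda>x. x\<^sup>2"] by blast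
qed

lift_definition evens :: "'a::complex_inner hsum \<Rightarrow> 'a hsum" is "\<lambda>h n. h (2 * n)"
proof -
  fix h :: "int \<Rightarrow> 'a"
  assume "(\<lambda>n. (norm (h n))\<^sup>2) summable_on UNIV"
  then have "(\<lambda>n. (norm (h n))\<^sup>2) summable_on range (\<lambda>n. 2 * n)"
    by (rule summable_on_subset_banach) simp
  then show "(\<lambda>n. (norm (h (2 * n)))\<^sup>2) summable_on UNIV"
    by (subst (asm) summable_on_reindex) (auto simp: inj_def comp_def)
qed

lift_definition odds :: "'a::complex_inner hsum \<Rightarrow> 'a hsum" is "\<lambda>h n. h (2 * n + 1)"
proof -
  fix h :: "int \<Rightarrow> 'a"
  assume "(\<lambda>n. (norm (h n))\<^sup>2) summable_on UNIV"
  then have "(\<lambda>n. (norm (h n))\<^sup>2) summable_on range (\<lambda>n. 2 * n + 1)"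
    by (rule summable_on_subset_banach) simp
  then show "(\<lambda>n. (norm (h (2 * n + 1)))\<^sup>2) summable_on UNIV"
    by (subst (asm) summable_on_reindex) (auto simp: inj_def comp_def)
qed

lemma evens_interleave [simp]: "evens (interleave h k) = h"
  by (rule hsum_eqI) (simp add: evens.rep_eq interleave.rep_eq)

lemma odds_interleave [simp]: "odds (interleave h k) = k"
  by (rule hsum_eqI) (simp add: odds.rep_eq interleave.rep_eq)

lemma interleave_evens_odds [simp]: "interleave (evens h) (odds h) = h"
  by (rule hsum_eqI) (auto simp: odds.rep_eq evens.rep_eq interleave.rep_eq)

lemma interleave_add: "interleave (h + h') (k + k') = interleave h k + interleave h' k'"
  by (rule hsum_eqI) (simp add: interleave.rep_eq plus_hsum.rep_eq)

lemma interleave_scaleC: "interleave (c *\<^sub>C h) (c *\<^sub>C k) = c *\<^sub>C interleave h k"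
  by (rule hsum_eqI) (simp add: interleave.rep_eq scaleC_hsum.rep_eq)

lemma evens_add: "evens (h + k) = evens h + evens k" and evens_scaleC: "evens (c *\<^sub>C h) = c *\<^sub>C evens h"
  and odds_add: "odds (h + k) = odds h + odds k" and odds_scaleC: "odds (c *\<^sub>C h) = c *\<^sub>C odds h"
  by (rule hsum_eqI, simp add: evens.rep_eq odds.rep_eq plus_hsum.rep_eq scaleC_hsum.rep_eq)+

lemma cinner_interleave:
  "cinner (interleave h k) (interleave h' k') = cinner h h' + cinner k k'"
proof -
  have sum: "((\<lambda>n. cinner (component x n) (component y n)) has_sum cinner x y) UNIV" for x y :: "'a hsum"
    unfolding cinner_hsum_def by (intro has_sum_infsum summable_on_cinner summable_component)
  have "((\<lambda>n. cinner (component (interleave h k) n) (component (interleave h' k') n))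
      has_sum (cinner h h' + cinner k k')) UNIV"
    using has_sum_interleave[OF sum[of h h'] sum[of k k']]
    by (rule has_sum_cong[THEN iffD1, rotated]) (simp add: interleave.rep_eq)
  then show ?thesis
    using sum has_sum_unique by blast
qed

definition direct_sum :: "('a hsum \<Rightarrow> 'a hsum) \<Rightarrow> ('a hsum \<Rightarrow> 'a hsum) \<Rightarrow> 'a::complex_inner hsum \<Rightarrow> 'a hsum" where
  "direct_sum U V h = interleave (U (evens h)) (V (odds h))"

lemma unitary_direct_sum:
  assumes U: "unitary_on UNIV U" and V: "unitary_on UNIV V"
  shows "unitary_on UNIV (direct_sum U V)"
proof (rule unitary_onI)
  note lin = unitary_bounded_clinear[OF U] unitary_bounded_clinear[OF V]
  show "direct_sum U V (x + y) = direct_sum U V x + direct_sum U V y" for x y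
    by (simp add: direct_sum_def evens_add odds_add lin[THEN bounded_clinear_add] interleave_add)
  show "direct_sum U V (c *\<^sub>C x) = c *\<^sub>C direct_sum U V x" for c x
    by (simp add: direct_sum_def evens_scaleC odds_scaleC lin[THEN bounded_clinear_scaleC] interleave_scaleC)
  show "cinner (direct_sum U V x) (direct_sum U V y) = cinner x y" for x y
    using cinner_interleave[of "evens x" "odds x" "evens y" "odds y"]
    by (simp add: direct_sum_def cinner_interleave unitary_cinner[OF U] unitary_cinner[OF V])
  show "surj (direct_sum U V)"
  proof (rule surjI)
    fix k
    show "direct_sum U V (interleave (inv U (evens k)) (inv V (odds k))) = k"
      by (simp add: direct_sum_def surj_f_inv_f[OF unitary_surj[OF U]] surj_f_inv_f[OF unitary_surj[OF V]])
  qed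
qed

text \<open>The ampliation \<open>\<Oplus> S\<close>; for an unbounded \<open>S\<close> the components need not be square summable.\<close>

definition diag :: "('a \<Rightarrow> 'a) \<Rightarrow> 'a::complex_inner hsum \<Rightarrow> 'a hsum" where
  "diag S h = Abs_hsum (\<lambda>n. S (component h n))"

lemma component_diag:
  assumes "unitary_on UNIV S"
  shows "component (diag S h) n = S (component h n)"
  unfolding diag_def
  by (subst Abs_hsum_inverse) (simp_all add: unitary_norm[OF assms] summable_component)

lemma unitary_diag:
  assumes S: "unitary_on UNIV S"
  shows "unitary_on UNIV (diag S)"
proof (rule unitary_onI)
  note lin = unitary_bounded_clinear[OF S]
  show "diag S (x + y) = diag S x + diag S y" for x y
    by (rule hsum_eqI) (simp add: component_diag[OF S] plus_hsum.rep_eq bounded_clinear_add[OF lin])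
  show "diag S (c *\<^sub>C x) = c *\<^sub>C diag S x" for c x
    by (rule hsum_eqI) (simp add: component_diag[OF S] scaleC_hsum.rep_eq bounded_clinear_scaleC[OF lin])
  show "cinner (diag S x) (diag S y) = cinner x y" for x y
    by (simp add: cinner_hsum_def component_diag[OF S] unitary_cinner[OF S])
  have inv: "S (inv S y) = y" for y
    by (rule surj_f_inv_f[OF unitary_surj[OF S]])
  have norm_inv: "norm (inv S y) = norm y" for y
    using unitary_norm[OF S, of "inv S y"] inv by simp
  show "surj (diag S)"
  proof (rule surjI)
    fix k
    have "component (Abs_hsum (\<lambda>n. inv S (component k n))) n = inv S (component k n)" for n
      by (subst Abs_hsum_inverse) (simp_all add: norm_inv summable_component)
    then show "diag S (Abs_hsum (\<lambda>n. inv S (component k n))) = k"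
      by (intro hsum_eqI) (simp add: component_diag[OF S] inv)
  qed
qed

section \<open>The Schaeffer dilation is unitary\<close>

text \<open>Up to the shift of indices, the Schaeffer operator changes only the two coordinates that it maps
  to \<open>-1\<close> and \<open>0\<close>. It therefore preserves inner products as soon as it does so on these two.\<close>

lemma infsum_shift_modified:
  fixes f g :: "int \<Rightarrow> complex"
  assumes f: "f summable_on UNIV" and g: "g summable_on UNIV"
    and shift: "\<And>n. n \<noteq> -1 \<Longrightarrow> n \<noteq> 0 \<Longrightarrow> g n = f (n + 1)"
    and eq: "g (-1) + g 0 = f 0 + f 1"
  shows "infsum g UNIV = infsum f UNIV"
proof -
  let ?f = "\<lambda>n. f (n + 1)"
  have bij: "bij_betw (\<lambda>n::int. n + 1) UNIV UNIV"
    by (rule bij_betwI[where g = "\<lambda>n. n - 1"]) auto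
  have f': "?f summable_on UNIV"
    using summable_on_reindex_bij_betw[OF bij, of f] f by simp
  have split: "infsum u UNIV = u (-1) + u 0 + infsum u (- {-1, 0})" if "u summable_on UNIV" for u :: "int \<Rightarrow> complex"
  proof -
    have "infsum u ({-1, 0} \<union> - {-1, 0}) = infsum u {-1, 0} + infsum u (- {-1, 0})"
      using that by (intro infsum_Un_disjoint) (auto intro: summable_on_subset_banach)
    then show ?thesis
      by simp
  qed
  have "infsum g (- {-1, 0}) = infsum ?f (- {-1, 0})"
    by (rule infsum_cong) (auto simp: shift)
  then have "infsum g UNIV = infsum ?f UNIV"
    using split[OF g] split[OF f'] eq by simp
  also have "\<dots> = infsum f UNIV"
    by (rule infsum_reindex_bij_betw[OF bij])
  finally show ?thesis .
qed

lift_definition reflect :: "'a::complex_inner hsum \<Rightarrow> 'a hsum" is "\<lambda>h n. h (- n)"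
proof -
  fix h :: "int \<Rightarrow> 'a"
  have bij: "bij_betw uminus (UNIV :: int set) UNIV"
    by (rule bij_uminus)
  show "(\<lambda>n. (norm (h n))\<^sup>2) summable_on UNIV \<Longrightarrow> (\<lambda>n. (norm (h (- n)))\<^sup>2) summable_on UNIV"
    using summable_on_reindex_bij_betw[OF bij, of "\<lambda>n. (norm (h n))\<^sup>2"] by simp
qed

text \<open>Conjugating the dilation of \<open>R\<^sup>*\<close> with the reflection \<open>n \<mapsto> - n\<close> gives the adjoint of the
  dilation of \<open>R\<close>. As a right inverse of the dilation it shows surjectivity.\<close>

lemma schaeffer_reflect:
  fixes R :: "'a::{complex_inner, complete_space} \<Rightarrow> 'a"
  assumes R: "contraction R"
  shows "schaeffer R (reflect (schaeffer (cadjoint R) (reflect k))) = k"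
proof (rule hsum_eqI)
  fix n
  note R' = contraction_cadjoint[OF R]
  note lin = contraction_bounded_clinear[OF R] contraction_bounded_clinear[OF R']
    bounded_clinear_defect[OF R] bounded_clinear_defect[OF R']
  have "cadjoint R (defect (cadjoint R) x) = defect R (cadjoint R x)" for x
    using contraction_defect_commute[OF R'] by (simp add: defect_star_eq[OF R'] cadjoint_cadjoint[OF R])
  then show "component (schaeffer R (reflect (schaeffer (cadjoint R) (reflect k)))) n = component k n"
    using contraction_defect_commute[OF R]
    by (simp add: schaeffer.rep_eq reflect.rep_eq defect_star_eq[OF R] defect_star_eq[OF R']
      cadjoint_cadjoint[OF R] lin[THEN bounded_clinear_add] lin[THEN bounded_clinear_diff]
      defect_defect[OF R] defect_defect[OF R'])
qed

lemma unitary_schaeffer: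
  fixes R :: "'a::{complex_inner, complete_space} \<Rightarrow> 'a"
  assumes R: "contraction R"
  shows "unitary_on UNIV (schaeffer R)"
proof (rule unitary_onI)
  note R' = contraction_cadjoint[OF R]
  note lin = contraction_bounded_clinear[OF R] contraction_bounded_clinear[OF R']
    bounded_clinear_defect[OF R] bounded_clinear_defect[OF R']
  show "schaeffer R (x + y) = schaeffer R x + schaeffer R y" for x y
    by (rule hsum_eqI)
       (simp add: schaeffer.rep_eq plus_hsum.rep_eq defect_star_eq[OF R] lin[THEN bounded_clinear_add])
  show "schaeffer R (c *\<^sub>C x) = c *\<^sub>C schaeffer R x" for c x
    by (rule hsum_eqI)
       (simp add: schaeffer.rep_eq scaleC_hsum.rep_eq defect_star_eq[OF R] lin[THEN bounded_clinear_scaleC]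
         scaleC_add_right scaleC_diff_right)
  show "cinner (schaeffer R x) (schaeffer R y) = cinner x y" for x y
    unfolding cinner_hsum_def
  proof (rule infsum_shift_modified)
    \<comment> \<open>the mixed terms cancel because \<open>R D\<^sub>R = D\<^sub>R\<^sub>* R\<close>\<close>
    have cross: "cinner (defect R u) (cadjoint R v) = cinner (R u) (defect (cadjoint R) v)"
        "cinner (cadjoint R v) (defect R u) = cinner (defect (cadjoint R) v) (R u)" for u v
      using contraction_defect_commute[OF R]
      by (simp_all add: cinner_cadjoint[OF lin(1)] cinner_cadjoint_left[OF lin(1)] defect_star_eq[OF R]
          defect_selfadjoint[OF R'])
    show "cinner (component (schaeffer R x) (- 1)) (component (schaeffer R y) (- 1)) +
      cinner (component (schaeffer R x) 0) (component (schaeffer R y) 0) =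
      cinner (component x 0) (component y 0) + cinner (component x 1) (component y 1)"
      by (simp add: schaeffer.rep_eq defect_star_eq[OF R] cinner_linear cinner_defect_defect[OF R]
          cinner_defect_defect[OF R'] cross)
  qed (simp_all only: summable_on_cinner summable_component, simp add: schaeffer.rep_eq)
  show "surj (schaeffer R)"
    by (rule surjI) (rule schaeffer_reflect[OF R])
qed

lemma schaeffer_commutes_diag:
  fixes S T :: "'a::{complex_inner, complete_space} \<Rightarrow> 'a"
  assumes S: "unitary_on UNIV S" and T: "contraction T" and comm: "\<And>x. S (T x) = T (S x)"
  shows "schaeffer T (diag S h) = diag S (schaeffer T h)"
proof -
  note lin = unitary_bounded_clinear[OF S]
  show ?thesis
    by (rule hsum_eqI)
       (simp add: schaeffer.rep_eq component_diag[OF S] bounded_clinear_add[OF lin] bounded_clinear_diff[OF lin]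
         unitary_commutes_cadjoint[OF assms] unitary_commutes_defect[OF assms] comm)
qed

section \<open>The two dilations\<close>

text \<open>Far out to the right the dilation is the shift whatever \<open>R\<close> is. Index \<open>1\<close> is excluded: there
  \<open>R\<^sup>*\<close> and \<open>D\<^sub>R\<^sub>*\<close> enter.\<close>

lemma schaeffer_single_ge_2:
  fixes R :: "'a::{complex_inner, complete_space} \<Rightarrow> 'a"
  assumes R: "contraction R" and m: "m \<ge> 2"
  shows "schaeffer R (single m x) = single (m - 1) x"
proof -
  note R' = contraction_cadjoint[OF R]
  note zero = bounded_clinear_zero[OF contraction_bounded_clinear[OF R]]
    bounded_clinear_zero[OF contraction_bounded_clinear[OF R']]
    bounded_clinear_zero[OF bounded_clinear_defect[OF R]]
    bounded_clinear_zero[OF bounded_clinear_defect[OF R']]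
  show ?thesis
    using m by (intro hsum_eqI) (auto simp: schaeffer.rep_eq single.rep_eq defect_star_eq[OF R] zero)
qed

lemma schaeffer_single_0:
  fixes R :: "'a::{complex_inner, complete_space} \<Rightarrow> 'a"
  assumes R: "contraction R"
  shows "schaeffer R (single 0 x) = single (- 1) (defect R x) + single 0 (R x)"
proof -
  note R' = contraction_cadjoint[OF R]
  note zero = bounded_clinear_zero[OF contraction_bounded_clinear[OF R']]
    bounded_clinear_zero[OF bounded_clinear_defect[OF R']]
  show ?thesis
    by (rule hsum_eqI) (simp add: schaeffer.rep_eq single.rep_eq plus_hsum.rep_eq defect_star_eq[OF R] zero)
qed

lemma norm_single [simp]: "norm (single m x) = norm x"
proof -
  have "complex_of_real ((norm (single m x))\<^sup>2) = complex_of_real ((norm x)\<^sup>2)"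
    unfolding cinner_self[symmetric] by (simp add: single.rep_eq)
  then show ?thesis
    unfolding of_real_eq_iff by simp
qed

text \<open>On \<open>y\<^sub>n\<close> at index \<open>0\<close> the two dilations have the inner product
  \<open>\<parallel>D\<^sub>T y\<^sub>n\<parallel>\<^sup>2 + \<langle>T y\<^sub>n, S T y\<^sub>n\<rangle>\<close>, by the equality of the defect operators; this is the sequence of the
  hypothesis. At index \<open>2\<close> both dilations are the same shift, which supplies the vector on which
  they agree, with image at index \<open>1\<close>, away from the images \<open>-1\<close> and \<open>0\<close> of index \<open>0\<close>.\<close>

lemma schaeffer_bj_orthogonal:
  fixes S T :: "'a::{complex_inner, complete_space} \<Rightarrow> 'a" and y :: "nat \<Rightarrow> 'a"
  assumes T: "contraction T" and S: "unitary_on UNIV S"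
    and y: "\<And>n. norm (y n) = 1"
    and lim: "(\<lambda>n. 1 - complex_of_real ((norm (T (y n)))\<^sup>2) + cinner (T (y n)) (S (T (y n)))) \<longlonglongrightarrow> l"
    and l: "l \<in> \<real>\<^sub>\<le>\<^sub>0"
  shows "bj_orthogonal_on UNIV (schaeffer T) (schaeffer (S \<circ> T))"
proof -
  note ST = contraction_compose[OF unitary_contraction[OF S] T]
  show ?thesis
  proof (rule bj_orthogonal_unitaries[where x = "\<lambda>n. single 0 (y n)" and z = "single 2 (y 0)"])
    show "unitary_on UNIV (schaeffer T)" "unitary_on UNIV (schaeffer (S \<circ> T))"
      by (intro unitary_schaeffer T ST)+
    have "cinner (schaeffer T (single 0 (y n))) (schaeffer (S \<circ> T) (single 0 (y n)))
        = 1 - complex_of_real ((norm (T (y n)))\<^sup>2) + cinner (T (y n)) (S (T (y n)))" for n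
    proof -
      have "cinner (defect T (y n)) (defect T (y n)) = 1 - complex_of_real ((norm (T (y n)))\<^sup>2)"
        unfolding cinner_defect_defect[OF T] by (simp add: cinner_self y)
      then show ?thesis
        by (simp add: schaeffer_single_0[OF T] schaeffer_single_0[OF ST] cinner_linear single.rep_eq
            plus_hsum.rep_eq defect_unitary_compose[OF S T])
    qed
    then show "(\<lambda>n. cinner (schaeffer T (single 0 (y n))) (schaeffer (S \<circ> T) (single 0 (y n)))) \<longlonglongrightarrow> l"
      using lim by simp
  qed (simp_all add: l y schaeffer_single_0[OF T] schaeffer_single_0[OF ST] cinner_linear single.rep_eq plus_hsum.rep_eq
      schaeffer_single_ge_2[OF T] schaeffer_single_ge_2[OF ST])
qed

lemma orth_proj_range_eqI:
  assumes J: "bounded_clinear J" and orth: "\<And>w. cinner (h - J x) (J w) = 0"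
  shows "orth_proj (range J) h = J x"
  unfolding orth_proj_def
proof (rule the_equality)
  show "J x \<in> range J \<and> (\<forall>z\<in>range J. cinner (h - J x) z = 0)"
    using orth by auto
  fix y assume "y \<in> range J \<and> (\<forall>z\<in>range J. cinner (h - y) z = 0)"
  then obtain x' where y: "y = J x'" and y_orth: "\<And>w. cinner (h - J x') (J w) = 0"
    by auto
  have "cinner (J x - J x') (J (x - x')) = cinner (h - J x') (J (x - x')) - cinner (h - J x) (J (x - x'))"
    by (simp add: cinner_diff_left)
  also have "\<dots> = 0"
    by (simp only: orth y_orth diff_self)
  finally have "cinner (J x - J x') (J x - J x') = 0"
    by (simp only: bounded_clinear_diff[OF J])
  then show "y = J x"
    by (simp add: y cinner_self)
qed

text \<open>The Schaeffer operator is upper triangular: no index \<open>n \<ge> 1\<close> is reached from the indices \<open>n \<le> 0\<close>.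
  On vectors without components at \<open>n \<ge> 1\<close> its powers therefore act at index \<open>0\<close> as the powers of the
  contraction, whatever is collected at negative indices.\<close>

definition lower_at :: "'a::complex_inner \<Rightarrow> 'a hsum set" where
  "lower_at x = {k. component k 0 = x \<and> (\<forall>n\<ge>1. component k n = 0)}"

lemma schaeffer_lower_at:
  fixes T :: "'a::{complex_inner, complete_space} \<Rightarrow> 'a"
  assumes T: "contraction T" and k: "k \<in> lower_at x"
  shows "schaeffer T k \<in> lower_at (T x)"
  using k bounded_clinear_zero[OF bounded_clinear_defect[OF contraction_cadjoint[OF T]]]
  by (auto simp: lower_at_def schaeffer.rep_eq defect_star_eq[OF T])

lemma diag_lower_at:
  assumes S: "unitary_on UNIV S" and k: "k \<in> lower_at x"
  shows "diag S k \<in> lower_at (S x)"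
  using k bounded_clinear_zero[OF unitary_bounded_clinear[OF S]]
  by (auto simp: lower_at_def component_diag[OF S])

lemma funpow_lower_at:
  assumes "\<And>k x. k \<in> lower_at x \<Longrightarrow> U k \<in> lower_at (T x)" and "evens h \<in> lower_at x"
  shows "evens ((direct_sum U V ^^ n) h) \<in> lower_at ((T ^^ n) x)"
  by (induction n) (simp_all add: assms direct_sum_def)

lemma bounded_clinear_embed: "bounded_clinear (\<lambda>x. interleave (single 0 x) 0)"
proof (rule bounded_clinearI[where K = 1])
  show "interleave (single 0 (x + y)) 0 = interleave (single 0 x) 0 + interleave (single 0 y) (0 :: 'a hsum)" for x y :: 'a
    unfolding interleave_add[symmetric]
    by (rule arg_cong2[where f = interleave]) (auto intro!: hsum_eqI simp: single.rep_eq plus_hsum.rep_eq)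
  show "interleave (single 0 (c *\<^sub>C x)) 0 = c *\<^sub>C interleave (single 0 x) (0 :: 'a hsum)" for c and x :: 'a
    unfolding interleave_scaleC[symmetric]
    by (rule arg_cong2[where f = interleave]) (auto intro!: hsum_eqI simp: single.rep_eq scaleC_hsum.rep_eq)
  have "cinner (interleave (single 0 x) 0) (interleave (single 0 x) 0) = cinner (single 0 x) (single 0 x)" for x :: 'a
    by (simp add: cinner_interleave)
  then show "norm (interleave (single 0 x) 0) \<le> norm x * 1" for x :: 'a
    using norm_eq_if_cinner_eq[of "interleave (single 0 x) 0" "single 0 x"] by simp
qed

text \<open>\<open>\<Oplus> S\<close> commutes with the dilation of \<open>T\<close>, because \<open>S\<close> commutes with every entry of its matrix. Hence the
  dilation of \<open>T\<close> and its product with \<open>\<Oplus> S\<close> are commuting unitaries that dilate \<open>T\<close> and \<open>ST\<close>. A further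
  summand, here the identity on the odd indices, does not affect the compression to index \<open>0\<close>.\<close>

lemma commuting_unitary_dilation:
  fixes S T :: "'a::{complex_inner, complete_space} \<Rightarrow> 'a"
  assumes T: "contraction T" and S: "unitary_on UNIV S" and comm: "\<And>x. S (T x) = T (S x)"
  shows "unitary_dilation UNIV (\<lambda>x. interleave (single 0 x) 0)
    (direct_sum (schaeffer T) id) (direct_sum (diag S \<circ> schaeffer T) id) T (S \<circ> T)"
proof -
  let ?J = "\<lambda>x::'a. interleave (single 0 x) 0"
  let ?U1 = "direct_sum (schaeffer T) id" and ?U2 = "direct_sum (diag S \<circ> schaeffer T) id"
  have dil: "?J ((T ^^ n1) (((S \<circ> T) ^^ n2) x)) = orth_proj (range ?J) ((?U1 ^^ n1) ((?U2 ^^ n2) (?J x)))"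
    for n1 n2 x
  proof (rule sym, rule orth_proj_range_eqI[OF bounded_clinear_embed])
    fix w
    let ?h = "(?U1 ^^ n1) ((?U2 ^^ n2) (?J x))" and ?y = "(T ^^ n1) (((S \<circ> T) ^^ n2) x)"
    have "evens (?J x) \<in> lower_at x"
      by (simp add: lower_at_def single.rep_eq)
    then have "evens ?h \<in> lower_at ?y"
      by (intro funpow_lower_at) (simp_all add: schaeffer_lower_at[OF T] diag_lower_at[OF S])
    then have 0: "component (evens ?h) 0 = ?y"
      by (simp add: lower_at_def)
    have "cinner ?h (?J w) = cinner (interleave (evens ?h) (odds ?h)) (?J w)"
      by (simp only: interleave_evens_odds)
    also have "\<dots> = cinner ?y w"
      by (simp only: cinner_interleave cinner_single_right 0 cinner_zero_right add_0_right)
    finally show "cinner (?h - ?J ?y) (?J w) = 0"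
      unfolding cinner_diff_left cinner_interleave by (simp add: single.rep_eq)
  qed
  show ?thesis
    unfolding unitary_dilation_def
  proof (intro conjI allI ballI dil bounded_clinear_embed)
    show "closed_csubspace (UNIV :: 'a hsum set)"
      by (simp add: closed_csubspace_def)
    show "cinner (?J x) (?J y) = cinner x y" for x y
      by (simp add: cinner_interleave single.rep_eq)
    show "unitary_on UNIV ?U1" "unitary_on UNIV ?U2"
      by (intro unitary_direct_sum unitary_compose unitary_diag unitary_schaeffer unitary_id T S)+
    show "?U1 (?U2 k) = ?U2 (?U1 k)" for k
      by (simp add: direct_sum_def schaeffer_commutes_diag[OF S T comm])
  qed simp
qed

text \<open>Without the identity summand orthogonality can fail: for \<open>S = - I\<close> the second dilation would be the
  negative of the first. On the even indices, a vector \<open>y\<^sub>n\<close> far to the right is merely shifted by the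
  first dilation, and the form becomes \<open>\<langle>y\<^sub>n, S y\<^sub>n\<rangle>\<close>. On the odd indices the two dilations agree.\<close>

lemma commuting_dilation_bj_orthogonal:
  fixes S T :: "'a::{complex_inner, complete_space} \<Rightarrow> 'a"
  assumes T: "contraction T" and S: "unitary_on UNIV S"
    and l: "l \<in> maximal_numerical_range S" "l \<in> \<real>\<^sub>\<le>\<^sub>0"
  shows "bj_orthogonal_on UNIV (direct_sum (schaeffer T) id) (direct_sum (diag S \<circ> schaeffer T) id)"
proof -
  obtain y :: "nat \<Rightarrow> 'a" where y: "\<And>n. norm (y n) = 1" and lim: "(\<lambda>n. cinner (S (y n)) (y n)) \<longlonglongrightarrow> l"
    using l(1) by (auto simp: maximal_numerical_range_def)
  have norm: "norm (interleave h 0) = norm h" "norm (interleave 0 h) = norm h" for h :: "'a hsum"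
    by (rule norm_eq_if_cinner_eq, simp add: cinner_interleave)+
  have zero: "schaeffer T 0 = 0" "diag S 0 = 0"
    by (intro bounded_clinear_zero unitary_bounded_clinear unitary_schaeffer unitary_diag T S)+
  show ?thesis
  proof (rule bj_orthogonal_unitaries[where x = "\<lambda>n. interleave (single 2 (y n)) 0"
        and z = "interleave 0 (single 0 (y 0))"])
    show "unitary_on UNIV (direct_sum (schaeffer T) id)"
      "unitary_on UNIV (direct_sum (diag S \<circ> schaeffer T) id)"
      by (intro unitary_direct_sum unitary_compose unitary_diag unitary_schaeffer unitary_id T S)+
    have "(\<lambda>n. cnj (cinner (S (y n)) (y n))) \<longlonglongrightarrow> cnj l"
      by (intro tendsto_intros lim)
    then show "(\<lambda>n. cinner (direct_sum (schaeffer T) id (interleave (single 2 (y n)) 0))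
        (direct_sum (diag S \<circ> schaeffer T) id (interleave (single 2 (y n)) 0))) \<longlonglongrightarrow> cnj l"
      by (simp add: direct_sum_def schaeffer_single_ge_2[OF T] cinner_interleave component_diag[OF S]
          single.rep_eq cinner_commute[symmetric])
    \<comment> \<open>the conjugate appears because the numerical range has \<open>S\<close> in the first argument\<close>
    show "cnj l \<in> \<real>\<^sub>\<le>\<^sub>0"
      using l(2) by (auto simp: nonpos_Reals_def)
  qed (simp_all add: y norm direct_sum_def schaeffer_single_ge_2[OF T] cinner_interleave zero zero_hsum.rep_eq)
qed

theorem theorem7p2:
  fixes T S :: "'a::separable_hilbert \<Rightarrow> 'a"
  assumes "contraction T" and "unitary_on UNIV S"
  shows
    "((\<exists>(y :: nat \<Rightarrow> 'a) (l :: complex).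
        (\<forall>n. norm (y n) = 1) \<and>
        (\<lambda>n. 1 - complex_of_real ((norm (T (y n)))\<^sup>2) + cinner (T (y n)) (S (T (y n)))) \<longlonglongrightarrow> l \<and>
        l \<in> \<real>\<^sub>\<le>\<^sub>0)
      \<longrightarrow> bj_orthogonal_on UNIV (schaeffer T) (schaeffer (S \<circ> T)))
    \<and>
    (S \<circ> T = T \<circ> S \<and> (\<exists>l \<in> maximal_numerical_range S. l \<in> \<real>\<^sub>\<le>\<^sub>0)
      \<longrightarrow> (\<exists>(K :: 'a hsum set) J U_T U_ST.
            unitary_dilation K J U_T U_ST T (S \<circ> T) \<and> bj_orthogonal_on K U_T U_ST))"
proof (rule conjI; rule impI)
  assume "\<exists>(y :: nat \<Rightarrow> 'a) (l :: complex).
        (\<forall>n. norm (y n) = 1) \<and>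
        (\<lambda>n. 1 - complex_of_real ((norm (T (y n)))\<^sup>2) + cinner (T (y n)) (S (T (y n)))) \<longlonglongrightarrow> l \<and>
        l \<in> \<real>\<^sub>\<le>\<^sub>0"
  then show "bj_orthogonal_on UNIV (schaeffer T) (schaeffer (S \<circ> T))"
    using schaeffer_bj_orthogonal[OF assms] by blast
next
  assume *: "S \<circ> T = T \<circ> S \<and> (\<exists>l \<in> maximal_numerical_range S. l \<in> \<real>\<^sub>\<le>\<^sub>0)"
  then have "S (T x) = T (S x)" for x
    by (auto simp: fun_eq_iff)
  from commuting_unitary_dilation[OF assms this] commuting_dilation_bj_orthogonal[OF assms] *
  show "\<exists>(K :: 'a hsum set) J U_T U_ST.
            unitary_dilation K J U_T U_ST T (S \<circ> T) \<and> bj_orthogonal_on K U_T U_ST"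
    by blast
qed

end
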